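(* Let $\mathfrak{X}$ be a decoration set and let $\Psi:\mathfrak{X}\to\mathfrak{I}$ be a conservative function. Then the graded subspace $\mathbf{k}\mathfrak{D}$ of $\mathbf{k}\mathfrak{P}$ spanned by the elements $\mathbb{P}_{(\mathcal{D},\mathcal{X})}$, for all $\mathfrak{X}$-decorated noncrossing arc diagrams $(\mathcal{D},\mathcal{X})$, is a Hopf subalgebra of the Hopf algebra $(\mathbf{k}\mathfrak{P},\cdot,\triangle)$ of $\mathfrak{X}$-decorated permutations (that is, it is stable by the product $\cdot$, and $\triangle(\mathbf{k}\mathfrak{D})\subseteq\mathbf{k}\mathfrak{D}\otimes\mathbf{k}\mathfrak{D}$).
   Context: Notation. $\mathbb{N}=\{0,1,2,\dots\}$, $[n]=\{1,\dots,n\}$, $]a,b[\,=\{a+1,\dots,b-1\}$, $\mathfrak{S}_n$ is the set of permutations $\sigma=\sigma_1\dots\sigma_n$ of $[n]$ in one-line notation, $\mathfrak{S}=\bigsqcup_n\mathfrak{S}_n$, $\mathbf{k}$ is a field. Decoration sets. A decoration set is a graded set $\mathfrak{X}=\bigsqcup_{n\ge0}\mathfrak{X}_n$ with a concatenation $\mathsf{concat}:\mathfrak{X}_m\times\mathfrak{X}_n\to\mathfrak{X}_{m+n}$ for all $m,n\in\mathbb{N}$ and a selection $\mathsf{select}:\mathfrak{X}_m\times\binom{[m]}{k}\to\mathfrak{X}_k$ for all $m,k\in\mathbb{N}$ (where $\binom{[m]}{k}$ is the set of $k$-element subsets of $[m]$) such that (i) $\mathsf{concat}(\mathcal{X},\mathsf{concat}(\mathcal{Y},\mathcal{Z}))=\mathsf{concat}(\mathsf{concat}(\mathcal{X},\mathcal{Y}),\mathcal{Z})$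 for all $\mathcal{X},\mathcal{Y},\mathcal{Z}\in\mathfrak{X}$; (ii) $\mathsf{select}(\mathsf{select}(\mathcal{X},R),S)=\mathsf{select}(\mathcal{X},\{r_s : s\in S\})$ for all $\mathcal{X}\in\mathfrak{X}_p$, $R=\{r_1<\dots<r_q\}\subseteq[p]$, $S\subseteq[q]$; (iii) $\mathsf{concat}(\mathsf{select}(\mathcal{X},R),\mathsf{select}(\mathcal{Y},S))=\mathsf{select}(\mathsf{concat}(\mathcal{X},\mathcal{Y}),R\cup S^{\rightarrow m})$ for all $\mathcal{X}\in\mathfrak{X}_m$, $\mathcal{Y}\in\mathfrak{X}_n$, $R\subseteq[m]$, $S\subseteq[n]$, where $S^{\rightarrow m}=\{s+m : s\in S\}$. Hopf algebras. Here a (combinatorial) Hopf algebra is a vector space with an associative product $\cdot$ and a coassociative coproduct $\triangle$ such that $\triangle(x\cdot y)=\triangle(x)\cdot\triangle(y)$, the product on the right being $(x_1\otimes x_2)\cdot(y_1\otimes y_2)=(x_1\cdot y_1)\otimes(x_2\cdot y_2)$. Decorated permutations. An $\mathfrak{X}$-decorated permutation of size $n$ is a pair $(\sigma,\mathcal{X})\in\mathfrak{P}_n:=\mathfrak{S}_n\times\mathfrak{X}_n$; $\mathbf{k}\mathfrak{P}=\bigoplus_n\mathbf{k}\mathfrak{P}_n$ has basis $(\mathbb{F}_{(\sigma,\mathcal{X})})$ indexed by $\mathfrak{P}=\bigsqcup_n\mathfrak{P}_n$. For $\rho\in\mathfrak{S}_p$ and $R\subseteq[p]$, $\mathsf{stdp}(\rho,R)$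 (resp. $\mathsf{stdv}(\rho,R)$) is the standardization (the permutation with the same relative order) of the word obtained from $\rho$ by deleting the entries whose positions (resp. values) are not in $R$. For $\sigma\in\mathfrak{S}_m$, $\tau\in\mathfrak{S}_n$, the shifted shuffle is $\sigma\,\bar{\sqcup\!\sqcup}\,\tau=\{\rho\in\mathfrak{S}_{m+n} : \mathsf{stdv}(\rho,[m])=\sigma,\ \mathsf{stdv}(\rho,[m+n]\setminus[m])=\tau\}$. The product and coproduct on $\mathbf{k}\mathfrak{P}$ are $\mathbb{F}_{(\sigma,\mathcal{X})}\cdot\mathbb{F}_{(\tau,\mathcal{Y})}=\sum_{\rho\in\sigma\,\bar{\sqcup\!\sqcup}\,\tau}\mathbb{F}_{(\rho,\mathsf{concat}(\mathcal{X},\mathcal{Y}))}$ and $\triangle\mathbb{F}_{(\rho,\mathcal{Z})}=\sum_{k=0}^p\mathbb{F}_{\mathsf{std}((\rho,\mathcal{Z}),[k])}\otimes\mathbb{F}_{\mathsf{std}((\rho,\mathcal{Z}),[p]\setminus[k])}$ for $(\rho,\mathcal{Z})\in\mathfrak{P}_p$, where $\mathsf{std}((\rho,\mathcal{Z}),R)=(\mathsf{stdp}(\rho,R),\mathsf{select}(\mathcal{Z},\rho(R)))$ and $\rho(R)=\{\rho_i : i\in R\}$. These make $\mathbf{k}\mathfrak{P}$ a graded Hopf algebra. Arcs. An arc is a quadruple $(a,b,n,S)$ with $1\le a<b\le n$ and $S\subseteq\,]a,b[$; $\mathcal{A}_n$ is the set of arcs with third entry $n$. Two arcs $(a,b,n,R)$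 and $(c,d,n,S)$ cross if there exist $r,s\in([a,b]\cap[c,d])\setminus(\{a,b\}\cap\{c,d\})$ with $r\in(R\cup\{a,b\})\setminus S$ and $s\in(S\cup\{c,d\})\setminus R$. A noncrossing arc diagram is a set $\mathcal{D}\subseteq\mathcal{A}_n$ such that any two distinct arcs of $\mathcal{D}$ do not cross, have distinct left endpoints and have distinct right endpoints. An arc ideal of $\mathcal{A}_n$ is a set $\mathcal{I}\subseteq\mathcal{A}_n$ such that $(a,d,n,S)\in\mathcal{I}$ implies $(b,c,n,S\cap\,]b,c[)\in\mathcal{I}$ for all $a\le b<c\le d$. $\mathfrak{I}_n$ is the set of arc ideals of $\mathcal{A}_n$ and $\mathfrak{I}=\bigsqcup_n\mathfrak{I}_n$. For an arc $\alpha=(a,b,m,S)$ and $n\in\mathbb{N}$, $\alpha^{+n}=(a,b,m+n,S)$ and $\alpha^{\rightarrow n}=(a+n,b+n,m+n,\{s+n : s\in S\})$; for a set $\mathcal{I}$ of arcs, $\mathcal{I}^{+n}$ and $\mathcal{I}^{\rightarrow n}$ are obtained by applying these operations to all elements. Conservative functions. A graded function $\Psi:\mathfrak{X}\to\mathfrak{I}$ (so $\Psi(\mathfrak{X}_n)\subseteq\mathfrak{I}_n$) is conservative if (i) $\Psi(\mathcal{X})^{+n}$ and $\Psi(\mathcal{Y})^{\rightarrow m}$ are both subsets of $\Psi(\mathsf{concat}(\mathcal{X},\mathcal{Y}))$ for any $\mathcal{X}\in\mathfrak{X}_m$, $\mathcal{Y}\in\mathfrak{X}_n$; (ii) $(r_a,r_b,p,S)\in\Psi(\mathcal{Z})$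 implies $(a,b,q,\{c\in[q] : r_c\in S\})\in\Psi(\mathsf{select}(\mathcal{Z},R))$ for any $\mathcal{Z}\in\mathfrak{X}_p$, $R=\{r_1<\dots<r_q\}\subseteq[p]$, $1\le a<b\le q$ and $S\subseteq\,]r_a,r_b[$. The map $\underline{\eta}_{\mathcal{I}}$. The weak order on $\mathfrak{S}_n$ is $\sigma\le\tau$ iff $\mathrm{inv}(\sigma)\subseteq\mathrm{inv}(\tau)$, where $\mathrm{inv}(\sigma)=\{(\sigma_i,\sigma_j) : i<j,\ \sigma_i>\sigma_j\}$; it is a lattice. A descent of $\sigma$ is an $i\in[n-1]$ with $\sigma_i>\sigma_{i+1}$; put $\underline{\alpha}(i,i+1,\sigma)=(\sigma_{i+1},\sigma_i,n,\{\sigma_j : j<i,\ \sigma_j\in\,]\sigma_{i+1},\sigma_i[\,\})$ and $\underline{\delta}(\sigma)=\{\underline{\alpha}(i,i+1,\sigma) : i\text{ descent of }\sigma\}$. For a lattice congruence $\equiv$ of the weak order on $\mathfrak{S}_n$, each class is an interval; let $\pi_\downarrow^{\equiv}(\sigma)$ be the minimal element of the class of $\sigma$, and let $\mathcal{I}_\equiv$ be the set of arcs $\underline{\alpha}(i,i+1,\sigma)$ where $\sigma$ is a permutation with exactly one descent $i$ and $\pi_\downarrow^{\equiv}(\sigma)=\sigma$. By a theorem of Reading, $\equiv\,\mapsto\mathcal{I}_\equiv$ is a bijection from lattice congruences of the weak order on $\mathfrak{S}_n$ to arc ideals of $\mathcal{A}_n$; moreover $\equiv$ is the equivalence relation generated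 by $\sigma\equiv\sigma\cdot(i\;i+1)$ (swap of the entries in positions $i,i+1$) for descents $i$ of $\sigma$ with $\underline{\alpha}(i,i+1,\sigma)\notin\mathcal{I}_\equiv$, and $\underline{\delta}\circ\pi_\downarrow^{\equiv}$ induces a bijection from the $\equiv$-classes to the noncrossing arc diagrams contained in $\mathcal{I}_\equiv$. For $\mathcal{I}=\mathcal{I}_\equiv$, define $\underline{\eta}_{\mathcal{I}}(\sigma)=\underline{\delta}(\pi_\downarrow^{\equiv}(\sigma))$. Decorated noncrossing arc diagrams. An $\mathfrak{X}$-decorated noncrossing arc diagram of size $n$ is a pair $(\mathcal{D},\mathcal{X})$ with $\mathcal{X}\in\mathfrak{X}_n$ and $\mathcal{D}$ a noncrossing arc diagram contained in $\Psi(\mathcal{X})$. For it, set $\mathbb{P}_{(\mathcal{D},\mathcal{X})}=\sum_{\sigma\in\mathfrak{S}_n,\ \underline{\eta}_{\Psi(\mathcal{X})}(\sigma)=\mathcal{D}}\mathbb{F}_{(\sigma,\mathcal{X})}$. *)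

theory Defs
  imports
    "HOL-Library.Poly_Mapping"
    "HOL-Library.Disjoint_Sets"
    "HOL-Combinatorics.Multiset_Permutations"
    "HOL-Algebra.Lattice"
begin

section \<open>Permutations in one-line notation\<close>

abbreviation perms :: "nat \<Rightarrow> nat list set"
  where "perms n \<equiv> permutations_of_set {1..n}"

text \<open>Positions are counted from 1: \<open>entry \<sigma> i\<close> is the i-th letter of the word.\<close>

definition entry :: "nat list \<Rightarrow> nat \<Rightarrow> nat"
  where "entry \<sigma> i = \<sigma> ! (i - 1)"

text \<open>Standardization is only used for words without repeated letters.\<close>

definition std_word :: "nat list \<Rightarrow> nat list"
  where "std_word w = map (\<lambda>x. card {y \<in> set w. y \<le> x}) w"

definition stdp :: "nat list \<Rightarrow> nat set \<Rightarrow> nat list"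
  where "stdp \<rho> R = std_word (nths \<rho> {i. Suc i \<in> R})"

definition stdv :: "nat list \<Rightarrow> nat set \<Rightarrow> nat list"
  where "stdv \<rho> R = std_word (filter (\<lambda>v. v \<in> R) \<rho>)"

definition shifted_shuffle :: "nat list \<Rightarrow> nat list \<Rightarrow> nat list set"
  where "shifted_shuffle \<sigma> \<tau> =
    (let m = length \<sigma>; n = length \<tau> in
     {\<rho> \<in> perms (m + n). stdv \<rho> {1..m} = \<sigma> \<and> stdv \<rho> ({1..m+n} - {1..m}) = \<tau>})"


section \<open>The weak order and its lattice congruences\<close>

definition inversions :: "nat list \<Rightarrow> (nat \<times> nat) set"
  where "inversions \<sigma> =
    {(entry \<sigma> i, entry \<sigma> j) | i j.
      1 \<le> i \<and> i < j \<and> j \<le> length \<sigma> \<and> entry \<sigma> i > entry \<sigma> j}"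

definition weak_order :: "nat \<Rightarrow> nat list gorder"
  where "weak_order n =
    \<lparr>carrier = perms n, eq = (=), le = (\<lambda>\<sigma> \<tau>. inversions \<sigma> \<subseteq> inversions \<tau>)\<rparr>"

definition weak_congruence :: "nat \<Rightarrow> (nat list \<times> nat list) set \<Rightarrow> bool"
  where "weak_congruence n C \<longleftrightarrow>
    equiv (perms n) C \<and>
    (\<forall>\<sigma> \<sigma>' \<tau> \<tau>'. (\<sigma>, \<sigma>') \<in> C \<longrightarrow> (\<tau>, \<tau>') \<in> C \<longrightarrow>
      (\<sigma> \<squnion>\<^bsub>weak_order n\<^esub> \<tau>, \<sigma>' \<squnion>\<^bsub>weak_order n\<^esub> \<tau>') \<in> C \<and>
      (\<sigma> \<sqinter>\<^bsub>weak_order n\<^esub> \<tau>, \<sigma>' \<sqinter>\<^bsub>weak_order n\<^esub> \<tau>') \<in> C)"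

definition pi_down :: "nat \<Rightarrow> (nat list \<times> nat list) set \<Rightarrow> nat list \<Rightarrow> nat list"
  where "pi_down n C \<sigma> = (THE \<tau>. least (weak_order n) \<tau> (C `` {\<sigma>}))"


section \<open>Arcs\<close>

type_synonym arc = "nat \<times> nat \<times> nat \<times> nat set"

definition arcs :: "nat \<Rightarrow> arc set"
  where "arcs n = {(a, b, n, S) | a b S. 1 \<le> a \<and> a < b \<and> b \<le> n \<and> S \<subseteq> {a<..<b}}"

fun cross :: "arc \<Rightarrow> arc \<Rightarrow> bool"
  where "cross (a, b, n, R) (c, d, n', S) \<longleftrightarrow>
    (\<exists>r s. r \<in> ({a..b} \<inter> {c..d}) - ({a, b} \<inter> {c, d}) \<and>
           s \<in> ({a..b} \<inter> {c..d}) - ({a, b} \<inter> {c, d}) \<and>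
           r \<in> (R \<union> {a, b}) - S \<and> s \<in> (S \<union> {c, d}) - R)"

definition left_end :: "arc \<Rightarrow> nat"
  where "left_end \<alpha> = fst \<alpha>"

definition right_end :: "arc \<Rightarrow> nat"
  where "right_end \<alpha> = fst (snd \<alpha>)"

definition noncrossing_arc_diagram :: "nat \<Rightarrow> arc set \<Rightarrow> bool"
  where "noncrossing_arc_diagram n D \<longleftrightarrow>
    D \<subseteq> arcs n \<and>
    (\<forall>\<alpha>\<in>D. \<forall>\<beta>\<in>D. \<alpha> \<noteq> \<beta> \<longrightarrow>
      \<not> cross \<alpha> \<beta> \<and> left_end \<alpha> \<noteq> left_end \<beta> \<and> right_end \<alpha> \<noteq> right_end \<beta>)"

definition arc_ideal :: "nat \<Rightarrow> arc set \<Rightarrow> bool"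
  where "arc_ideal n I \<longleftrightarrow>
    I \<subseteq> arcs n \<and>
    (\<forall>a b c d S. (a, d, n, S) \<in> I \<longrightarrow> a \<le> b \<longrightarrow> b < c \<longrightarrow> c \<le> d \<longrightarrow>
      (b, c, n, S \<inter> {b<..<c}) \<in> I)"

fun arc_extend :: "nat \<Rightarrow> arc \<Rightarrow> arc"
  where "arc_extend n (a, b, m, S) = (a, b, m + n, S)"

fun arc_shift :: "nat \<Rightarrow> arc \<Rightarrow> arc"
  where "arc_shift n (a, b, m, S) = (a + n, b + n, m + n, (\<lambda>s. s + n) ` S)"


section \<open>From permutations to noncrossing arc diagrams\<close>

definition descent :: "nat list \<Rightarrow> nat \<Rightarrow> bool"
  where "descent \<sigma> i \<longleftrightarrow> 1 \<le> i \<and> i < length \<sigma> \<and> entry \<sigma> i > entry \<sigma> (i + 1)"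

definition alpha_down :: "nat \<Rightarrow> nat list \<Rightarrow> arc"
  where "alpha_down i \<sigma> =
    (entry \<sigma> (i + 1), entry \<sigma> i, length \<sigma>,
     {entry \<sigma> j | j. 1 \<le> j \<and> j < i \<and> entry \<sigma> j \<in> {entry \<sigma> (i + 1)<..<entry \<sigma> i}})"

definition delta_down :: "nat list \<Rightarrow> arc set"
  where "delta_down \<sigma> = {alpha_down i \<sigma> | i. descent \<sigma> i}"

definition congruence_arcs :: "nat \<Rightarrow> (nat list \<times> nat list) set \<Rightarrow> arc set"
  where "congruence_arcs n C =
    {alpha_down i \<sigma> | i \<sigma>. \<sigma> \<in> perms n \<and> {j. descent \<sigma> j} = {i} \<and> pi_down n C \<sigma> = \<sigma>}"

text \<open>The description is proper for every arc ideal \<open>I\<close> of size \<open>n\<close>: by Reading's theorem,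
  \<open>congruence_arcs n\<close> is a bijection from the lattice congruences of the weak order
  to the arc ideals.\<close>

definition arc_congruence :: "nat \<Rightarrow> arc set \<Rightarrow> (nat list \<times> nat list) set"
  where "arc_congruence n I = (THE C. weak_congruence n C \<and> congruence_arcs n C = I)"

definition eta_down :: "nat \<Rightarrow> arc set \<Rightarrow> nat list \<Rightarrow> arc set"
  where "eta_down n I \<sigma> = delta_down (pi_down n (arc_congruence n I) \<sigma>)"


section \<open>Decoration sets and conservative functions\<close>

text \<open>For \<open>R = {r\<^sub>1 < \<dots> < r\<^sub>q}\<close>, \<open>nth_elem R s\<close> is \<open>r\<^sub>s\<close>.\<close>

definition nth_elem :: "nat set \<Rightarrow> nat \<Rightarrow> nat"
  where "nth_elem R s = sorted_list_of_set R ! (s - 1)"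

text \<open>The graded set is the family of its (disjoint) homogeneous pieces \<open>X n\<close>. The values of
  \<open>conc\<close> and \<open>sel\<close> outside the stated domains are irrelevant.\<close>

locale decoration_set =
  fixes X :: "nat \<Rightarrow> 'x set"
    and conc :: "'x \<Rightarrow> 'x \<Rightarrow> 'x"
    and sel :: "'x \<Rightarrow> nat set \<Rightarrow> 'x"
  assumes disjoint: "disjoint_family X"
    and conc_closed: "\<And>m n x y. x \<in> X m \<Longrightarrow> y \<in> X n \<Longrightarrow> conc x y \<in> X (m + n)"
    and sel_closed: "\<And>m x R. x \<in> X m \<Longrightarrow> R \<subseteq> {1..m} \<Longrightarrow> sel x R \<in> X (card R)"
    and conc_assoc: "\<And>m n p x y z. x \<in> X m \<Longrightarrow> y \<in> X n \<Longrightarrow> z \<in> X p \<Longrightarrow>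
      conc x (conc y z) = conc (conc x y) z"
    and sel_sel: "\<And>p x R S. x \<in> X p \<Longrightarrow> R \<subseteq> {1..p} \<Longrightarrow> S \<subseteq> {1..card R} \<Longrightarrow>
      sel (sel x R) S = sel x (nth_elem R ` S)"
    and conc_sel: "\<And>m n x y R S. x \<in> X m \<Longrightarrow> y \<in> X n \<Longrightarrow> R \<subseteq> {1..m} \<Longrightarrow> S \<subseteq> {1..n} \<Longrightarrow>
      conc (sel x R) (sel y S) = sel (conc x y) (R \<union> (\<lambda>s. s + m) ` S)"

locale conservative_function = decoration_set X conc sel
  for X :: "nat \<Rightarrow> 'x set" and conc :: "'x \<Rightarrow> 'x \<Rightarrow> 'x" and sel :: "'x \<Rightarrow> nat set \<Rightarrow> 'x" +
  fixes Psi :: "'x \<Rightarrow> arc set"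
  assumes Psi_ideal: "\<And>n x. x \<in> X n \<Longrightarrow> arc_ideal n (Psi x)"
    and Psi_conc_left: "\<And>m n x y. x \<in> X m \<Longrightarrow> y \<in> X n \<Longrightarrow>
      arc_extend n ` Psi x \<subseteq> Psi (conc x y)"
    and Psi_conc_right: "\<And>m n x y. x \<in> X m \<Longrightarrow> y \<in> X n \<Longrightarrow>
      arc_shift m ` Psi y \<subseteq> Psi (conc x y)"
    and Psi_sel: "\<And>p z R a b S. z \<in> X p \<Longrightarrow> R \<subseteq> {1..p} \<Longrightarrow>
      1 \<le> a \<Longrightarrow> a < b \<Longrightarrow> b \<le> card R \<Longrightarrow>
      S \<subseteq> {nth_elem R a<..<nth_elem R b} \<Longrightarrow>
      (nth_elem R a, nth_elem R b, p, S) \<in> Psi z \<Longrightarrow>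
      (a, b, card R, {c \<in> {1..card R}. nth_elem R c \<in> S}) \<in> Psi (sel z R)"


section \<open>Free vector spaces\<close>

text \<open>The vector space with basis indexed by \<open>'a\<close> is \<open>'a \<Rightarrow>\<^sub>0 'k\<close>, and the tensor product of
  the spaces with bases \<open>'a\<close> and \<open>'b\<close> is the space with basis \<open>'a \<times> 'b\<close>.\<close>

definition free_scale :: "'k::field \<Rightarrow> ('a \<Rightarrow>\<^sub>0 'k) \<Rightarrow> ('a \<Rightarrow>\<^sub>0 'k)"
  where "free_scale c v = Poly_Mapping.map ((*) c) v"

lemma lookup_free_scale:
  "Poly_Mapping.lookup (free_scale c v) a = c * Poly_Mapping.lookup v a"
  by (simp add: free_scale_def Poly_Mapping.map.rep_eq when_def)

global_interpretation free_vs: vector_space free_scale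
  by unfold_locales
    (auto intro!: poly_mapping_eqI simp: lookup_free_scale lookup_add algebra_simps)

definition basis_vec :: "'a \<Rightarrow> ('a \<Rightarrow>\<^sub>0 'k::field)"
  where "basis_vec a = Poly_Mapping.single a 1"

definition linear_extension ::
    "('a \<Rightarrow> ('b \<Rightarrow>\<^sub>0 'k::field)) \<Rightarrow> ('a \<Rightarrow>\<^sub>0 'k) \<Rightarrow> ('b \<Rightarrow>\<^sub>0 'k)"
  where "linear_extension f v =
    (\<Sum>a\<in>Poly_Mapping.keys v. free_scale (Poly_Mapping.lookup v a) (f a))"

definition bilinear_extension ::
    "('a \<Rightarrow> 'b \<Rightarrow> ('c \<Rightarrow>\<^sub>0 'k::field)) \<Rightarrow> ('a \<Rightarrow>\<^sub>0 'k) \<Rightarrow> ('b \<Rightarrow>\<^sub>0 'k) \<Rightarrow> ('c \<Rightarrow>\<^sub>0 'k)"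
  where "bilinear_extension f u v = linear_extension (\<lambda>a. linear_extension (f a) v) u"

definition tensor :: "('a \<Rightarrow>\<^sub>0 'k::field) \<Rightarrow> ('b \<Rightarrow>\<^sub>0 'k) \<Rightarrow> ('a \<times> 'b \<Rightarrow>\<^sub>0 'k)"
  where "tensor = bilinear_extension (\<lambda>a b. basis_vec (a, b))"

definition tensor_space ::
    "('a \<Rightarrow>\<^sub>0 'k::field) set \<Rightarrow> ('b \<Rightarrow>\<^sub>0 'k) set \<Rightarrow> ('a \<times> 'b \<Rightarrow>\<^sub>0 'k) set"
  where "tensor_space U V = free_vs.span {tensor u v | u v. u \<in> U \<and> v \<in> V}"

definition graded_subspace :: "(nat \<Rightarrow> ('a \<Rightarrow>\<^sub>0 'k::field) set) \<Rightarrow> ('a \<Rightarrow>\<^sub>0 'k) set \<Rightarrow> bool"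
  where "graded_subspace H W \<longleftrightarrow>
    free_vs.subspace W \<and> W = free_vs.span (\<Union>n. W \<inter> H n)"

definition hopf_subalgebra ::
    "('a \<Rightarrow>\<^sub>0 'k::field) set \<Rightarrow> (('a \<Rightarrow>\<^sub>0 'k) \<Rightarrow> ('a \<Rightarrow>\<^sub>0 'k) \<Rightarrow> ('a \<Rightarrow>\<^sub>0 'k)) \<Rightarrow>
     (('a \<Rightarrow>\<^sub>0 'k) \<Rightarrow> ('a \<times> 'a \<Rightarrow>\<^sub>0 'k)) \<Rightarrow> ('a \<Rightarrow>\<^sub>0 'k) set \<Rightarrow> bool"
  where "hopf_subalgebra H prd coprd W \<longleftrightarrow>
    W \<subseteq> H \<and> free_vs.subspace W \<and>
    (\<forall>u\<in>W. \<forall>v\<in>W. prd u v \<in> W) \<and>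
    coprd ` W \<subseteq> tensor_space W W"


section \<open>Decorated permutations and decorated noncrossing arc diagrams\<close>

type_synonym 'x decperm = "nat list \<times> 'x"

definition kP_degree :: "(nat \<Rightarrow> 'x set) \<Rightarrow> nat \<Rightarrow> ('x decperm \<Rightarrow>\<^sub>0 'k::field) set"
  where "kP_degree X n = free_vs.span (basis_vec ` (perms n \<times> X n))"

definition kP :: "(nat \<Rightarrow> 'x set) \<Rightarrow> ('x decperm \<Rightarrow>\<^sub>0 'k::field) set"
  where "kP X = free_vs.span (basis_vec ` (\<Union>n. perms n \<times> X n))"

definition kP_mult :: "('x \<Rightarrow> 'x \<Rightarrow> 'x) \<Rightarrow>
    ('x decperm \<Rightarrow>\<^sub>0 'k::field) \<Rightarrow> ('x decperm \<Rightarrow>\<^sub>0 'k) \<Rightarrow> ('x decperm \<Rightarrow>\<^sub>0 'k)"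
  where "kP_mult conc = bilinear_extension
    (\<lambda>(\<sigma>, x) (\<tau>, y). \<Sum>\<rho>\<in>shifted_shuffle \<sigma> \<tau>. basis_vec (\<rho>, conc x y))"

definition std_dec :: "('x \<Rightarrow> nat set \<Rightarrow> 'x) \<Rightarrow> 'x decperm \<Rightarrow> nat set \<Rightarrow> 'x decperm"
  where "std_dec sel = (\<lambda>(\<rho>, z) R. (stdp \<rho> R, sel z (entry \<rho> ` R)))"

definition kP_comult :: "('x \<Rightarrow> nat set \<Rightarrow> 'x) \<Rightarrow>
    ('x decperm \<Rightarrow>\<^sub>0 'k::field) \<Rightarrow> ('x decperm \<times> 'x decperm \<Rightarrow>\<^sub>0 'k)"
  where "kP_comult sel = linear_extension
    (\<lambda>(\<rho>, z). \<Sum>k = 0..length \<rho>.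
      tensor (basis_vec (std_dec sel (\<rho>, z) {1..k}))
             (basis_vec (std_dec sel (\<rho>, z) ({1..length \<rho>} - {1..k}))))"

definition decorated_diagrams ::
    "(nat \<Rightarrow> 'x set) \<Rightarrow> ('x \<Rightarrow> arc set) \<Rightarrow> nat \<Rightarrow> (arc set \<times> 'x) set"
  where "decorated_diagrams X Psi n =
    {(D, x). x \<in> X n \<and> noncrossing_arc_diagram n D \<and> D \<subseteq> Psi x}"

definition P_elem :: "('x \<Rightarrow> arc set) \<Rightarrow> nat \<Rightarrow> arc set \<times> 'x \<Rightarrow> ('x decperm \<Rightarrow>\<^sub>0 'k::field)"
  where "P_elem Psi n = (\<lambda>(D, x).
    \<Sum>\<sigma> | \<sigma> \<in> perms n \<and> eta_down n (Psi x) \<sigma> = D. basis_vec (\<sigma>, x))"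

definition kD :: "(nat \<Rightarrow> 'x set) \<Rightarrow> ('x \<Rightarrow> arc set) \<Rightarrow> ('x decperm \<Rightarrow>\<^sub>0 'k::field) set"
  where "kD X Psi = free_vs.span (\<Union>n. P_elem Psi n ` decorated_diagrams X Psi n)"

end

theory Submission
  imports Defs
begin

text \<open>
  A permutation is determined by its inversion set, and the inversion sets of the permutations of
  \<open>{1..n}\<close> are exactly the biclosed sets: those that are transitive and whose complements among the
  pairs \<open>y > x\<close> are transitive too. So joins in the weak order are transitive closures of unions.
  An arc \<open>(a, b, n, S)\<close> has its own inversion set \<open>arc_inversions\<close>, namely all pairs \<open>y > x\<close> in
  \<open>[a, b]\<close> with \<open>y\<close> in \<open>S \<union> {b}\<close> and \<open>x\<close> outside it; these are the inversion sets of the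
  permutations with a single descent. Every permutation is the join of the arcs of its descents
  (\<open>inversions_eq_trancl_delta_down\<close>).

  For an arc ideal \<open>I\<close>, write \<open>arcs_below I \<sigma>\<close> for the set of arcs in \<open>I\<close> whose inversion set is
  contained in that of \<open>\<sigma>\<close>. The heart of the matter is that \<open>eta_down n I\<close> has the same fibres as
  \<open>arcs_below I\<close> (\<open>eta_down_eq_iff\<close>). This is the part of Reading's theorem that the definition of
  \<open>eta_down\<close> rests on. Any lattice congruence is determined by its arcs in this way
  (\<open>weak_congruence_determined\<close>): the least element of a class is the join of arcs of the
  congruence. Conversely, equality of \<open>arcs_below I\<close> is a lattice congruence whose set of arcs
  is \<open>I\<close>. It is compatible with meets for trivial reasons; compatibility with joins
  (\<open>arc_ideal_join\<close>) is where the ideal property enters.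

  Consequently \<open>kD X Psi\<close> contains every sum of basis elements \<open>(\<sigma>, x)\<close> over a set of permutations
  that is closed under equality of \<open>arcs_below (Psi x)\<close>, and similarly for pairs of permutations and
  the tensor square. What remains are two implications between equalities of sets of arcs.
  For the product, \<open>arcs_below (Psi (conc x y)) \<rho>\<close> determines the sets of arcs below the two
  restrictions of \<open>\<rho>\<close> to small and to large values, as the extended and shifted arcs lie in
  \<open>Psi (conc x y)\<close> (\<open>shifted_shuffle_classes\<close>). For the coproduct, fix the set \<open>R\<close> of values in the
  prefix. Then \<open>arcs_below (Psi z)\<close> of a concatenation \<open>u @ v\<close> with \<open>R\<close> as the set of letters of
  \<open>u\<close> only depends on the sets of arcs below the standardizations of \<open>u\<close> and \<open>v\<close>
  (\<open>arcs_below_append\<close>): a pair with both entries in \<open>R\<close> is inverted because a restricted arc is,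
  and a pair with one entry on each side is inverted or not according to \<open>R\<close> alone.
\<close>


section \<open>Words as strict orders on their letters\<close>

text \<open>A word without repetitions is handled as the strict order in which its letters appear: this is
  the form in which restriction, concatenation and relabelling of words are easy to describe.\<close>

fun before :: "'a list \<Rightarrow> 'a \<Rightarrow> 'a \<Rightarrow> bool" where
  "before [] u v \<longleftrightarrow> False"
| "before (x # xs) u v \<longleftrightarrow> x = u \<and> v \<in> set xs \<or> before xs u v"

lemma before_in_set: "before xs u v \<Longrightarrow> u \<in> set xs \<and> v \<in> set xs"
  by (induction xs) auto

lemma before_append:
  "before (xs @ ys) u v \<longleftrightarrow> before xs u v \<or> before ys u v \<or> u \<in> set xs \<and> v \<in> set ys"
  by (induction xs) auto

lemma before_filter: "before (filter P xs) u v \<longleftrightarrow> before xs u v \<and> P u \<and> P v"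
  by (induction xs) (auto dest: before_in_set)

lemma before_map:
  assumes "inj_on f (set xs)" "u \<in> set xs" "v \<in> set xs"
  shows "before (map f xs) (f u) (f v) \<longleftrightarrow> before xs u v"
proof -
  have "before (map f ys) (f u) (f v) \<longleftrightarrow> before ys u v" if "set ys \<subseteq> set xs" for ys
    using that by (induction ys) (use assms in \<open>auto dest: inj_onD\<close>)
  then show ?thesis by blast
qed

lemma before_asym: "distinct xs \<Longrightarrow> before xs u v \<Longrightarrow> \<not> before xs v u"
  by (induction xs) (auto dest: before_in_set)

lemma before_irrefl: "distinct xs \<Longrightarrow> \<not> before xs u u"
  using before_asym by metis

lemma before_trans: "distinct xs \<Longrightarrow> before xs u v \<Longrightarrow> before xs v w \<Longrightarrow> before xs u w"
  by (induction xs) (auto dest: before_in_set)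

lemma before_total:
  "u \<in> set xs \<Longrightarrow> v \<in> set xs \<Longrightarrow> u \<noteq> v \<Longrightarrow> before xs u v \<or> before xs v u"
  by (induction xs) auto

lemma before_iff_nth: "before xs u v \<longleftrightarrow> (\<exists>i j. i < j \<and> j < length xs \<and> xs ! i = u \<and> xs ! j = v)"
proof (induction xs)
  case (Cons x xs)
  have "(\<exists>i j. i < j \<and> j < length (x # xs) \<and> (x # xs) ! i = u \<and> (x # xs) ! j = v) \<longleftrightarrow>
     (\<exists>j. j < length xs \<and> x = u \<and> xs ! j = v) \<or>
     (\<exists>i j. i < j \<and> j < length xs \<and> xs ! i = u \<and> xs ! j = v)" (is "?L \<longleftrightarrow> ?R")
  proof
    assume ?L
    then obtain i j where "i < j" "j < length (x # xs)" "(x # xs) ! i = u" "(x # xs) ! j = v"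
      by blast
    then show ?R by (cases j; cases i) auto
  next
    assume ?R then show ?L by (metis Suc_less_eq length_Cons nth_Cons_0 nth_Cons_Suc zero_less_Suc)
  qed
  then show ?case using Cons by (auto simp: in_set_conv_nth)
qed simp

lemma before_unique:
  assumes "distinct xs" "distinct ys" "set xs = set ys"
    "\<And>u v. u \<in> set xs \<Longrightarrow> v \<in> set xs \<Longrightarrow> before xs u v \<longleftrightarrow> before ys u v"
  shows "xs = ys"
  using assms
proof (induction xs arbitrary: ys)
  case (Cons x xs)
  then obtain y zs where ys: "ys = y # zs" by (cases ys) auto
  have "x = y"
  proof (rule ccontr)
    assume "x \<noteq> y"
    then have "y \<in> set xs" "x \<in> set zs" using Cons.prems(3) ys by auto
    then have "before (x # xs) x y" "before ys y x" using ys by auto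
    then show False using Cons.prems before_asym[of ys] by (metis before_in_set)
  qed
  have "xs = zs"
  proof (rule Cons.IH)
    show "distinct xs" "distinct zs"
      using Cons.prems ys by auto
    show "set xs = set zs"
      using Cons.prems ys \<open>x = y\<close> by (simp add: insert_ident)
    fix u v assume uv: "u \<in> set xs" "v \<in> set xs"
    then have "u \<noteq> x" using Cons.prems(1) by auto
    then show "before xs u v \<longleftrightarrow> before zs u v" using Cons.prems(4)[of u v] uv ys \<open>x = y\<close> by auto
  qed
  then show ?case using ys \<open>x = y\<close> by simp
qed simp

text \<open>Insertion: a new letter goes after its predecessors and before its successors.\<close>

lemma list_of_strict_order:
  assumes "finite A"
    and irr: "\<And>u. u \<in> A \<Longrightarrow> \<not> r u u"
    and tr: "\<And>u v w. u \<in> A \<Longrightarrow> v \<in> A \<Longrightarrow> w \<in> A \<Longrightarrow> r u v \<Longrightarrow> r v w \<Longrightarrow> r u w"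
    and tot: "\<And>u v. u \<in> A \<Longrightarrow> v \<in> A \<Longrightarrow> u \<noteq> v \<Longrightarrow> r u v \<or> r v u"
  shows "\<exists>xs. distinct xs \<and> set xs = A \<and> (\<forall>u\<in>A. \<forall>v\<in>A. before xs u v \<longleftrightarrow> r u v)"
  using assms
proof (induction A)
  case (insert a A)
  have "\<exists>xs. distinct xs \<and> set xs = A \<and> (\<forall>u\<in>A. \<forall>v\<in>A. before xs u v \<longleftrightarrow> r u v)"
    by (rule insert.IH) (use insert.prems in \<open>(blast | metis insertCI)+\<close>)
  then obtain xs where xs: "distinct xs" "set xs = A"
    "\<And>u v. u \<in> A \<Longrightarrow> v \<in> A \<Longrightarrow> before xs u v \<longleftrightarrow> r u v" by blast
  let ?ys = "filter (\<lambda>u. r u a) xs @ a # filter (\<lambda>u. r a u) xs"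
  note irr = insert.prems(1) and tr = insert.prems(2) and tot = insert.prems(3)
  have ra: "r u a \<longleftrightarrow> \<not> r a u" if "u \<in> A" for u
    using that tot[of u a] tr[of u a u] irr[of u] insert.hyps by blast
  have "distinct ?ys" using xs insert.hyps ra by auto
  moreover have "set ?ys = insert a A" using xs ra by auto
  moreover have "before ?ys u v \<longleftrightarrow> r u v" if uv: "u \<in> insert a A" "v \<in> insert a A" for u v
  proof -
    have "r u v" if "u \<in> A" "v \<in> A" "r u a" "r a v" using tr[of u a v] that by blast
    moreover have "r a v" if "u \<in> A" "v \<in> A" "r u v" "r a u" using tr[of a u v] that by blast
    moreover have "r u a" if "u \<in> A" "v \<in> A" "r u v" "r v a" using tr[of u v a] that by blast
    ultimately show ?thesis
      using uv xs irr[of a] insert.hyps ra by (auto simp: before_append before_filter dest: before_in_set)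
  qed
  ultimately show ?case by blast
qed simp

lemma permsD: "\<sigma> \<in> perms n \<Longrightarrow> distinct \<sigma> \<and> set \<sigma> = {1..n} \<and> length \<sigma> = n"
  by (auto simp: permutations_of_set_def dest: distinct_card)

lemma permsI: "distinct \<sigma> \<Longrightarrow> set \<sigma> = {1..n} \<Longrightarrow> \<sigma> \<in> perms n"
  by (rule permutations_of_setI)

lemma inversions_eq_before: "inversions \<sigma> = {(y, x). x < y \<and> before \<sigma> y x}"
proof -
  have "(y, x) \<in> inversions \<sigma> \<longleftrightarrow> x < y \<and> before \<sigma> y x" for x y
  proof
    assume "(y, x) \<in> inversions \<sigma>"
    then obtain i j where "y = entry \<sigma> i" "x = entry \<sigma> j" "1 \<le> i" "i < j" "j \<le> length \<sigma>" "x < y"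
      unfolding inversions_def by auto
    then show "x < y \<and> before \<sigma> y x"
      unfolding before_iff_nth entry_def by (intro conjI exI[of _ "i - 1"] exI[of _ "j - 1"]) auto
  next
    assume *: "x < y \<and> before \<sigma> y x"
    then obtain i j where "i < j" "j < length \<sigma>" "\<sigma> ! i = y" "\<sigma> ! j = x"
      unfolding before_iff_nth by auto
    with * have "\<exists>i j. (y, x) = (entry \<sigma> i, entry \<sigma> j) \<and> 1 \<le> i \<and> i < j \<and>
        j \<le> length \<sigma> \<and> entry \<sigma> i > entry \<sigma> j"
      by (intro exI[of _ "Suc i"] exI[of _ "Suc j"] conjI) (simp_all add: entry_def)
    then show "(y, x) \<in> inversions \<sigma>"
      unfolding inversions_def by blast
  qed
  then show ?thesis by auto
qed

section \<open>Inversion sets are the biclosed sets\<close>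

text \<open>The inversion sets of permutations of \<open>{1..n}\<close>, described intrinsically.\<close>

definition biclosed :: "nat \<Rightarrow> (nat \<times> nat) set \<Rightarrow> bool" where
  "biclosed n R \<longleftrightarrow> R \<subseteq> {(y, x). 1 \<le> x \<and> x < y \<and> y \<le> n} \<and> trans R \<and>
    (\<forall>x y z. (z, x) \<in> R \<longrightarrow> x < y \<longrightarrow> y < z \<longrightarrow> (z, y) \<in> R \<or> (y, x) \<in> R)"

lemma biclosed_bounds: "biclosed n R \<Longrightarrow> (y, x) \<in> R \<Longrightarrow> 1 \<le> x \<and> x < y \<and> y \<le> n"
  unfolding biclosed_def by blast

lemma biclosed_trans: "biclosed n R \<Longrightarrow> trans R"
  unfolding biclosed_def by blast

lemma biclosed_cotrans:
  "biclosed n R \<Longrightarrow> (z, x) \<in> R \<Longrightarrow> x < y \<Longrightarrow> y < z \<Longrightarrow> (z, y) \<in> R \<or> (y, x) \<in> R"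
  unfolding biclosed_def by blast

lemma biclosed_inversions:
  assumes "\<sigma> \<in> perms n"
  shows "biclosed n (inversions \<sigma>)"
  unfolding biclosed_def
proof (intro conjI allI impI)
  have d: "distinct \<sigma>" and s: "set \<sigma> = {1..n}" using permsD[OF assms] by auto
  show "inversions \<sigma> \<subseteq> {(y, x). 1 \<le> x \<and> x < y \<and> y \<le> n}"
    using s by (auto simp: inversions_eq_before dest!: before_in_set)
  show "trans (inversions \<sigma>)"
    by (rule transI) (auto simp: inversions_eq_before intro: before_trans[OF d])
  fix x y z assume "(z, x) \<in> inversions \<sigma>" "x < y" "y < z"
  then show "(z, y) \<in> inversions \<sigma> \<or> (y, x) \<in> inversions \<sigma>"
    using before_total[of y \<sigma> z] s before_trans[OF d, of y z x] before_in_set[of \<sigma> z x]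
    by (auto simp: inversions_eq_before)
qed

lemma before_iff_inversions:
  assumes "\<sigma> \<in> perms n" "u \<in> {1..n}" "v \<in> {1..n}"
  shows "before \<sigma> u v \<longleftrightarrow> (u, v) \<in> inversions \<sigma> \<or> u < v \<and> (v, u) \<notin> inversions \<sigma>"
  using permsD[OF assms(1)] assms(2,3) before_total[of u \<sigma> v] before_asym[of \<sigma> u v]
  before_irrefl[of \<sigma> u]
  by (cases u v rule: linorder_cases) (auto simp: inversions_eq_before)

lemma inversions_inj:
  assumes "\<sigma> \<in> perms n" "\<tau> \<in> perms n" "inversions \<sigma> = inversions \<tau>"
  shows "\<sigma> = \<tau>"
  using before_iff_inversions[OF assms(1)] before_iff_inversions[OF assms(2)]
    permsD[OF assms(1)] permsD[OF assms(2)] assms(3)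
  by (intro before_unique) auto

text \<open>A biclosed set \<open>R\<close> tells for every two values which of them comes first: the larger one if the
  pair is in \<open>R\<close>, and the smaller one otherwise. Transitivity of \<open>R\<close> and of its complement make this a
  strict total order, and the permutation is the word that lists it.\<close>

lemma biclosed_obtain_perm:
  assumes R: "biclosed n R"
  obtains \<sigma> where "\<sigma> \<in> perms n" "inversions \<sigma> = R"
proof -
  define r where "r = (\<lambda>u v. (u, v) \<in> R \<or> u < v \<and> (v, u) \<notin> R)"
  note b = biclosed_bounds[OF R] and c = biclosed_cotrans[OF R] and t = transD[OF biclosed_trans[OF R]]
  have "\<exists>xs. distinct xs \<and> set xs = {1..n} \<and> (\<forall>u\<in>{1..n}. \<forall>v\<in>{1..n}. before xs u v \<longleftrightarrow> r u v)"
  proof (rule list_of_strict_order)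
    fix u v w assume "r u v" and "r v w"
    then have uv: "(u, v) \<in> R \<or> u < v \<and> (v, u) \<notin> R"
      and vw: "(v, w) \<in> R \<or> v < w \<and> (w, v) \<notin> R" by (simp_all add: r_def)
    have "(u, w) \<in> R \<or> u < w \<and> (w, u) \<notin> R"
    proof (cases u w rule: linorder_cases)
      case less
      have "(w, u) \<notin> R"
      proof
        assume wu: "(w, u) \<in> R"
        consider "v < u" | "v = u" | "u < v" "v < w" | "v = w" | "w < v" by linarith
        then show False
        proof cases
          case 1 then show ?thesis using uv vw wu b[of v w] t[of w u v] less by auto
        next case 2 then show ?thesis using uv vw wu less b[of u u] b[of u w] by auto
        next case 3 then show ?thesis using uv vw wu c[of w u v] b[of u v] b[of v w] by auto
        next case 4 then show ?thesis using uv vw wu less b[of u w] by auto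
        next case 5 then show ?thesis using uv vw wu less t[of v w u] b[of u v] by auto
        qed
      qed
      then show ?thesis using less by simp
    next
      case equal then show ?thesis using uv vw b[of u v] b[of v u] by auto
    next
      case greater
      consider "v < w" | "v = w" | "w < v" "v < u" | "v = u" | "u < v" using greater by linarith
      then have "(u, w) \<in> R"
      proof cases
        case 1 then show ?thesis using uv vw c[of u v w] b[of v w] greater by auto
      next case 2 then show ?thesis using uv vw greater b[of w w] by auto
      next case 3 then show ?thesis using uv vw t[of u v w] by auto
      next case 4 then show ?thesis using uv vw greater by auto
      next case 5 then show ?thesis using uv vw c[of v w u] b[of u v] greater by auto
      qed
      then show ?thesis by simp
    qed
    then show "r u w" by (simp add: r_def)
  next
    show "finite {1..n}" by simp
    show "\<not> r u u" for u using b[of u u] by (auto simp: r_def)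
    show "r u v \<or> r v u" if "u \<noteq> v" for u v using that by (auto simp: r_def)
  qed
  then obtain xs where "distinct xs \<and> set xs = {1..n} \<and>
      (\<forall>u\<in>{1..n}. \<forall>v\<in>{1..n}. before xs u v \<longleftrightarrow> r u v)" ..
  then have xs: "distinct xs" "set xs = {1..n}"
    and r: "u \<in> {1..n} \<Longrightarrow> v \<in> {1..n} \<Longrightarrow> before xs u v \<longleftrightarrow> r u v" for u v
    by simp_all
  have "x < y \<and> before xs y x \<longleftrightarrow> (y, x) \<in> R" for y x
  proof
    assume *: "x < y \<and> before xs y x"
    then have "y \<in> {1..n}" "x \<in> {1..n}" using before_in_set[of xs y x] xs(2) by auto
    then show "(y, x) \<in> R" using * r[of y x] by (auto simp: r_def)
  next
    assume *: "(y, x) \<in> R"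
    then have "y \<in> {1..n}" "x \<in> {1..n}" "x < y" using b[of y x] by auto
    then show "x < y \<and> before xs y x" using * r[of y x] by (auto simp: r_def)
  qed
  then have "inversions xs = R" unfolding inversions_eq_before by auto
  then show ?thesis using that permsI[OF xs] by metis
qed

section \<open>Joins and meets in the weak order\<close>

text \<open>The inversion set of the reversed word. Complementation exchanges joins and meets.\<close>

definition inversion_complement :: "nat \<Rightarrow> (nat \<times> nat) set \<Rightarrow> (nat \<times> nat) set" where
  "inversion_complement n R = {(y, x). 1 \<le> x \<and> x < y \<and> y \<le> n} - R"

lemma biclosed_complement:
  assumes R: "biclosed n R"
  shows "biclosed n (inversion_complement n R)"
  unfolding biclosed_def
proof (intro conjI allI impI)
  show "trans (inversion_complement n R)"
    unfolding inversion_complement_def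
    by (rule transI) (use biclosed_cotrans[OF R] in auto)
  fix x y z assume "(z, x) \<in> inversion_complement n R" "x < y" "y < z"
  then show "(z, y) \<in> inversion_complement n R \<or> (y, x) \<in> inversion_complement n R"
    using transD[OF biclosed_trans[OF R], of z y x] by (auto simp: inversion_complement_def)
qed (auto simp: inversion_complement_def)

text \<open>Only cotransitivity needs an argument. Follow a chain from \<open>z\<close> down to \<open>x\<close>: the step that jumps over
  \<open>y\<close> lies in \<open>R\<close> or in \<open>S\<close>, and there it can be split at \<open>y\<close>, on one side or the other.\<close>

lemma biclosed_trancl_union:
  assumes R: "biclosed n R" and S: "biclosed n S"
  shows "biclosed n ((R \<union> S)\<^sup>+)"
  unfolding biclosed_def
proof (intro conjI allI impI)
  show sub: "(R \<union> S)\<^sup>+ \<subseteq> {(y, x). 1 \<le> x \<and> x < y \<and> y \<le> n}"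
  proof (rule subrelI)
    fix y x assume "(y, x) \<in> (R \<union> S)\<^sup>+"
    then show "(y, x) \<in> {(y, x). 1 \<le> x \<and> x < y \<and> y \<le> n}"
      by (induction rule: trancl.induct)
        (use biclosed_bounds[OF R] biclosed_bounds[OF S] in fastforce)+
  qed
  fix x y z assume zx: "(z, x) \<in> (R \<union> S)\<^sup>+" and xy: "x < y" and yz: "y < z"
  from zx xy yz show "(z, y) \<in> (R \<union> S)\<^sup>+ \<or> (y, x) \<in> (R \<union> S)\<^sup>+"
  proof (induction rule: converse_trancl_induct)
    case (base z)
    then show ?case using biclosed_cotrans[OF R, of z x y] biclosed_cotrans[OF S, of z x y] by blast
  next
    case (step z w)
    consider "y = w" | "y < w" | "w < y" by linarith
    then show ?case
    proof cases
      case 1 then show ?thesis using step.hyps(1) by blast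
    next
      case 2 then show ?thesis using step by (meson trancl_into_trancl2)
    next
      case 3
      then have "(z, y) \<in> R \<union> S \<or> (y, w) \<in> R \<union> S"
        using step.hyps(1) step.prems biclosed_cotrans[OF R, of z w y] biclosed_cotrans[OF S, of z w y]
        by blast
      then show ?thesis using step.hyps(2) by (meson r_into_trancl' trancl_into_trancl2)
    qed
  qed
qed simp

lemma trancl_union_least:
  assumes "biclosed n T" "R \<subseteq> T"
  shows "R\<^sup>+ \<subseteq> T"
  using trancl_mono_subset[OF assms(2)] trancl_id[OF biclosed_trans[OF assms(1)]] by simp

lemma carrier_weak_order [simp]: "carrier (weak_order n) = perms n"
  and le_weak_order [simp]: "le (weak_order n) \<sigma> \<tau> \<longleftrightarrow> inversions \<sigma> \<subseteq> inversions \<tau>"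
  by (simp_all add: weak_order_def)

lemma weak_order_least_unique:
  "least (weak_order n) a A \<Longrightarrow> least (weak_order n) b A \<Longrightarrow> a = b"
  unfolding least_def by (auto intro!: inversions_inj)

lemma weak_order_greatest_unique:
  "greatest (weak_order n) a A \<Longrightarrow> greatest (weak_order n) b A \<Longrightarrow> a = b"
  unfolding greatest_def by (auto intro!: inversions_inj)

text \<open>Least elements are unique, so the choice that defines the join is forced.\<close>

lemma weak_order_join:
  assumes s: "\<sigma> \<in> perms n" and t: "\<tau> \<in> perms n"
  shows "\<sigma> \<squnion>\<^bsub>weak_order n\<^esub> \<tau> \<in> perms n"
    and "inversions (\<sigma> \<squnion>\<^bsub>weak_order n\<^esub> \<tau>) = (inversions \<sigma> \<union> inversions \<tau>)\<^sup>+"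
proof -
  obtain j where j: "j \<in> perms n" "inversions j = (inversions \<sigma> \<union> inversions \<tau>)\<^sup>+"
    using biclosed_obtain_perm[OF biclosed_trancl_union[OF biclosed_inversions[OF s] biclosed_inversions[OF t]]]
    by blast
  have l: "least (weak_order n) j (Upper (weak_order n) {\<sigma>, \<tau>})"
    unfolding least_def Upper_def
    using s t j trancl_union_least[OF biclosed_inversions, of _ n "inversions \<sigma> \<union> inversions \<tau>"]
    by auto
  then have "\<sigma> \<squnion>\<^bsub>weak_order n\<^esub> \<tau> = j"
    unfolding join_def sup_def by (metis someI weak_order_least_unique)
  then show "\<sigma> \<squnion>\<^bsub>weak_order n\<^esub> \<tau> \<in> perms n"
    "inversions (\<sigma> \<squnion>\<^bsub>weak_order n\<^esub> \<tau>) = (inversions \<sigma> \<union> inversions \<tau>)\<^sup>+"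
    using j by auto
qed

text \<open>The meet is the complement of the transitive closure of the union of the complements.\<close>

lemma weak_order_meet:
  assumes s: "\<sigma> \<in> perms n" and t: "\<tau> \<in> perms n"
  shows "\<sigma> \<sqinter>\<^bsub>weak_order n\<^esub> \<tau> \<in> perms n"
    and "\<rho> \<in> perms n \<Longrightarrow> inversions \<rho> \<subseteq> inversions (\<sigma> \<sqinter>\<^bsub>weak_order n\<^esub> \<tau>) \<longleftrightarrow>
      inversions \<rho> \<subseteq> inversions \<sigma> \<and> inversions \<rho> \<subseteq> inversions \<tau>"
proof -
  let ?c = "inversion_complement n"
  let ?U = "(?c (inversions \<sigma>) \<union> ?c (inversions \<tau>))\<^sup>+"
  have "biclosed n (?c ?U)"
    by (intro biclosed_complement biclosed_trancl_union biclosed_inversions s t)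
  then obtain m where m: "m \<in> perms n" "inversions m = ?c ?U"
    using biclosed_obtain_perm by blast
  have m_below: "inversions m \<subseteq> inversions \<sigma> \<inter> inversions \<tau>"
    unfolding m(2) by (auto simp: inversion_complement_def)
  have m_max: "inversions \<rho> \<subseteq> inversions m"
    if "\<rho> \<in> perms n" "inversions \<rho> \<subseteq> inversions \<sigma>" "inversions \<rho> \<subseteq> inversions \<tau>" for \<rho>
  proof -
    have "?U \<subseteq> ?c (inversions \<rho>)"
      by (rule trancl_union_least[OF biclosed_complement[OF biclosed_inversions]])
        (use that in \<open>auto simp: inversion_complement_def\<close>)
    then show ?thesis
      unfolding m(2) using biclosed_inversions[OF that(1)]
      by (auto simp: inversion_complement_def biclosed_def)
  qed
  have "greatest (weak_order n) m (Lower (weak_order n) {\<sigma>, \<tau>})"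
    unfolding greatest_def Lower_def using s t m(1) m_below m_max by auto
  then have "\<sigma> \<sqinter>\<^bsub>weak_order n\<^esub> \<tau> = m"
    unfolding meet_def inf_def by (metis someI weak_order_greatest_unique)
  then show "\<sigma> \<sqinter>\<^bsub>weak_order n\<^esub> \<tau> \<in> perms n"
    "\<rho> \<in> perms n \<Longrightarrow> inversions \<rho> \<subseteq> inversions (\<sigma> \<sqinter>\<^bsub>weak_order n\<^esub> \<tau>) \<longleftrightarrow>
      inversions \<rho> \<subseteq> inversions \<sigma> \<and> inversions \<rho> \<subseteq> inversions \<tau>"
    using m(1) m_below m_max by auto
qed

section \<open>Arcs, descents and join-irreducible inversion sets\<close>

text \<open>Positions count from 0 here.\<close>

definition pos :: "'a list \<Rightarrow> 'a \<Rightarrow> nat" where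
  "pos xs v = (THE i. i < length xs \<and> xs ! i = v)"

lemma pos_nth: "distinct xs \<Longrightarrow> i < length xs \<Longrightarrow> pos xs (xs ! i) = i"
  unfolding pos_def by (rule the_equality) (auto simp: nth_eq_iff_index_eq)

lemma nth_pos:
  assumes "distinct xs" "v \<in> set xs"
  shows "pos xs v < length xs" "xs ! pos xs v = v"
  using assms pos_nth[OF assms(1)] by (auto simp: in_set_conv_nth)

lemma pos_eq_iff:
  "distinct xs \<Longrightarrow> u \<in> set xs \<Longrightarrow> v \<in> set xs \<Longrightarrow> pos xs u = pos xs v \<longleftrightarrow> u = v"
  using nth_pos(2) by metis

lemma before_iff_pos:
  assumes "distinct xs" "u \<in> set xs" "v \<in> set xs"
  shows "before xs u v \<longleftrightarrow> pos xs u < pos xs v"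
proof
  assume "before xs u v"
  then obtain i j where "i < j" "j < length xs" "xs ! i = u" "xs ! j = v"
    unfolding before_iff_nth by blast
  then show "pos xs u < pos xs v"
    using pos_nth[OF assms(1), of i] pos_nth[OF assms(1), of j] by (metis order.strict_trans)
next
  assume "pos xs u < pos xs v"
  then show "before xs u v"
    unfolding before_iff_nth using nth_pos[OF assms(1,2)] nth_pos[OF assms(1,3)]
    by (intro exI[of _ "pos xs u"] exI[of _ "pos xs v"] conjI)
qed

lemma inversions_iff_pos:
  assumes "\<sigma> \<in> perms n"
  shows "(y, x) \<in> inversions \<sigma> \<longleftrightarrow> 1 \<le> x \<and> x < y \<and> y \<le> n \<and> pos \<sigma> y < pos \<sigma> x"
proof -
  have d: "distinct \<sigma>" and s: "set \<sigma> = {1..n}" using permsD[OF assms] by auto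
  show ?thesis
  proof (cases "y \<in> set \<sigma> \<and> x \<in> set \<sigma>")
    case True
    then show ?thesis using before_iff_pos[OF d, of y x] s by (auto simp: inversions_eq_before)
  next
    case False
    then have "\<not> before \<sigma> y x" using before_in_set[of \<sigma> y x] by blast
    then show ?thesis using False s by (auto simp: inversions_eq_before)
  qed
qed

lemma arcs_iff: "(a, b, m, S) \<in> arcs n \<longleftrightarrow> m = n \<and> 1 \<le> a \<and> a < b \<and> b \<le> n \<and> S \<subseteq> {a<..<b}"
  unfolding arcs_def by auto

text \<open>The inversion set of the permutation
  \<open>1, \<dots>, a - 1\<close>, \<open>S\<close>, \<open>b\<close>, \<open>a\<close>, \<open>]a, b[ - S\<close>, \<open>b + 1, \<dots>, n\<close> (both sets in increasing order), whose only
  descent is at \<open>b, a\<close>.\<close>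

fun arc_inversions :: "arc \<Rightarrow> (nat \<times> nat) set" where
  "arc_inversions (a, b, n, S) = {(y, x). y \<in> insert b S \<and> x \<in> {a..<b} - S \<and> x < y}"

lemma biclosed_arc_inversions:
  assumes "\<alpha> \<in> arcs n"
  shows "biclosed n (arc_inversions \<alpha>)"
proof -
  obtain a b m S where \<alpha>: "\<alpha> = (a, b, m, S)" by (cases \<alpha>)
  then have "1 \<le> a" "b \<le> n" "S \<subseteq> {a<..<b}" using assms by (auto simp: arcs_iff)
  then show ?thesis
    unfolding \<alpha> biclosed_def by (auto intro!: transI)
qed

lemma arc_inversions_endpoints:
  "(a, b, m, S) \<in> arcs n \<Longrightarrow> (b, a) \<in> arc_inversions (a, b, m, S)"
  by (auto simp: arcs_iff)

lemma arc_inversions_inj: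
  assumes "\<alpha> \<in> arcs n" "\<beta> \<in> arcs n" "arc_inversions \<alpha> = arc_inversions \<beta>"
  shows "\<alpha> = \<beta>"
proof -
  obtain a b m S where \<alpha>: "\<alpha> = (a, b, m, S)" by (cases \<alpha>)
  obtain c d m' T where \<beta>: "\<beta> = (c, d, m', T)" by (cases \<beta>)
  have 1: "(b, a) \<in> arc_inversions \<beta>" "(d, c) \<in> arc_inversions \<alpha>"
    using arc_inversions_endpoints assms unfolding \<alpha> \<beta> by metis+
  have S: "m = n" "S \<subseteq> {a<..<b}" and T: "m' = n" "T \<subseteq> {c<..<d}"
    using assms(1,2) unfolding \<alpha> \<beta> by (auto simp: arcs_iff)
  have "b \<le> d" "c \<le> a" "d \<le> b" "a \<le> c" using 1 S T unfolding \<alpha> \<beta> by auto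
  then have ab: "c = a" "d = b" "m' = m" "S \<subseteq> {a<..<b}" "T \<subseteq> {a<..<b}"
    using S T by auto
  have "z \<in> S \<longleftrightarrow> z \<in> T" if "z \<in> {a<..<b}" for z
  proof -
    have "(z, a) \<in> arc_inversions \<alpha> \<longleftrightarrow> z \<in> S" "(z, a) \<in> arc_inversions \<beta> \<longleftrightarrow> z \<in> T"
      using that ab unfolding \<alpha> \<beta> by auto
    then show ?thesis using assms(3) by simp
  qed
  then show ?thesis using ab unfolding \<alpha> \<beta> by auto
qed

text \<open>The hypotheses say that in the word with inversion set \<open>R\<close> all of \<open>S\<close> precedes \<open>b\<close> and all of
  \<open>]a, b[ - S\<close> follows \<open>a\<close>; as \<open>b\<close> precedes \<open>a\<close>, this fixes all inversions of the arc.\<close>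

lemma arc_inversions_subset:
  assumes R: "biclosed n R" and ba: "(b, a) \<in> R"
    and S: "\<And>z. z \<in> S \<Longrightarrow> a < z \<Longrightarrow> z < b \<Longrightarrow> (b, z) \<notin> R"
    and nS: "\<And>z. z \<notin> S \<Longrightarrow> a < z \<Longrightarrow> z < b \<Longrightarrow> (z, a) \<notin> R"
    and sub: "S \<subseteq> {a<..<b}"
  shows "arc_inversions (a, b, m, S) \<subseteq> R"
proof (rule subrelI)
  fix y x assume "(y, x) \<in> arc_inversions (a, b, m, S)"
  then have y: "y \<in> insert b S" and x: "x \<in> {a..<b} - S" and xy: "x < y" by auto
  have ya: "(y, a) \<in> R"
    using y x xy ba S biclosed_cotrans[OF R ba, of y] sub by fastforce
  show "(y, x) \<in> R"
  proof (cases "x = a")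
    case False
    then show ?thesis using x xy nS[of x] biclosed_cotrans[OF R ya, of x] by auto
  qed (use ya in simp)
qed

text \<open>The permutation of an arc is join-irreducible: whatever lies strictly below it misses the pair
  \<open>(b, a)\<close>.\<close>

lemma arc_inversions_lower_cover:
  assumes R: "biclosed n R" and \<alpha>: "(a, b, m, S) \<in> arcs n"
    and sub: "R \<subseteq> arc_inversions (a, b, m, S)" and ba: "(b, a) \<in> R"
  shows "R = arc_inversions (a, b, m, S)"
  by (rule equalityI[OF sub arc_inversions_subset[OF R ba]])
    (use sub \<alpha> in \<open>auto simp: arcs_iff\<close>)

text \<open>In terms of positions a descent is a pair of values \<open>b > a\<close> with \<open>a\<close> immediately after \<open>b\<close>.\<close>

lemma delta_down_pos:
  assumes "\<sigma> \<in> perms n"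
  shows "delta_down \<sigma> = {(a, b, n, {v \<in> {a<..<b}. pos \<sigma> v < pos \<sigma> b}) | a b.
    1 \<le> a \<and> a < b \<and> b \<le> n \<and> pos \<sigma> a = Suc (pos \<sigma> b)}" (is "_ = ?D")
proof -
  have d: "distinct \<sigma>" and s: "set \<sigma> = {1..n}" and l: "length \<sigma> = n" using permsD[OF assms] by auto
  have nth: "\<sigma> ! i \<in> {1..n}" if "i < n" for i using that s l nth_mem by metis
  have pn: "pos \<sigma> (\<sigma> ! i) = i" if "i < n" for i using pos_nth[OF d] that l by auto
  have np: "pos \<sigma> v < n" "\<sigma> ! pos \<sigma> v = v" if "1 \<le> v" "v \<le> n" for v
    using nth_pos[OF d, of v] that s l by auto
  have alpha: "alpha_down (Suc i) \<sigma> = (a, b, n, {v \<in> {a<..<b}. pos \<sigma> v < pos \<sigma> b})"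
    if "Suc i < n" and ab: "a = \<sigma> ! Suc i" "b = \<sigma> ! i" for i a b
  proof -
    have "{entry \<sigma> j | j. 1 \<le> j \<and> j < Suc i \<and> entry \<sigma> j \<in> {a<..<b}} =
      {v \<in> {a<..<b}. pos \<sigma> v < i}" (is "?A = ?B")
    proof (intro equalityI subsetI)
      fix v assume "v \<in> ?A"
      then obtain j where "v = \<sigma> ! (j - 1)" "1 \<le> j" "j < Suc i" "v \<in> {a<..<b}"
        unfolding entry_def by auto
      then show "v \<in> ?B" using pn[of "j - 1"] that(1) by auto
    next
      fix v assume v: "v \<in> ?B"
      then have "1 \<le> v" "v \<le> n" using nth[of i] that by auto
      then have "v = entry \<sigma> (Suc (pos \<sigma> v))" using np[of v] by (simp add: entry_def)
      then show "v \<in> ?A" using v by (intro CollectI exI[of _ "Suc (pos \<sigma> v)"]) auto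
    qed
    then show ?thesis
      unfolding alpha_down_def using that pn[of i] by (simp add: entry_def l)
  qed
  show ?thesis
  proof (intro equalityI subsetI)
    fix \<alpha> assume "\<alpha> \<in> delta_down \<sigma>"
    then obtain j where j: "descent \<sigma> j" "\<alpha> = alpha_down j \<sigma>" unfolding delta_down_def by auto
    then obtain i where i: "j = Suc i" unfolding descent_def by (cases j) auto
    have i': "Suc i < n" "\<sigma> ! Suc i < \<sigma> ! i" using j unfolding descent_def i entry_def l by auto
    show "\<alpha> \<in> ?D"
      unfolding j(2) i alpha[OF i'(1) refl refl]
      using i' nth[of i] nth[of "Suc i"] pn[of i] pn[of "Suc i"]
      by (intro CollectI exI[of _ "\<sigma> ! Suc i"] exI[of _ "\<sigma> ! i"]) auto
  next
    fix \<alpha> assume "\<alpha> \<in> ?D"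
    then obtain a b where \<alpha>: "\<alpha> = (a, b, n, {v \<in> {a<..<b}. pos \<sigma> v < pos \<sigma> b})"
      and ab: "1 \<le> a" "a < b" "b \<le> n" "pos \<sigma> a = Suc (pos \<sigma> b)" by auto
    let ?i = "pos \<sigma> b"
    have "a = \<sigma> ! Suc ?i" "b = \<sigma> ! ?i" "Suc ?i < n"
      using np[of a] np[of b] ab by auto
    then show "\<alpha> \<in> delta_down \<sigma>"
      unfolding delta_down_def descent_def \<alpha> using alpha[of ?i a b] ab
      by (intro CollectI exI[of _ "Suc ?i"]) (auto simp: entry_def l)
  qed
qed

lemma delta_downE:
  assumes "\<sigma> \<in> perms n" "\<alpha> \<in> delta_down \<sigma>"
  obtains a b where "\<alpha> = (a, b, n, {v \<in> {a<..<b}. pos \<sigma> v < pos \<sigma> b})"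
    "1 \<le> a" "a < b" "b \<le> n" "pos \<sigma> a = Suc (pos \<sigma> b)"
  using assms(2) unfolding delta_down_pos[OF assms(1)] by auto

lemma delta_down_subset_arcs:
  assumes "\<sigma> \<in> perms n"
  shows "delta_down \<sigma> \<subseteq> arcs n"
  unfolding delta_down_pos[OF assms] by (auto simp: arcs_iff)

lemma arc_inversions_delta_down:
  assumes s: "\<sigma> \<in> perms n" and "\<alpha> \<in> delta_down \<sigma>"
  shows "arc_inversions \<alpha> \<subseteq> inversions \<sigma>"
proof -
  obtain a b where \<alpha>: "\<alpha> = (a, b, n, {v \<in> {a<..<b}. pos \<sigma> v < pos \<sigma> b})"
    and ab: "1 \<le> a" "a < b" "b \<le> n" "pos \<sigma> a = Suc (pos \<sigma> b)"
    using delta_downE[OF s assms(2)] .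
  have eq: "pos \<sigma> x \<noteq> pos \<sigma> b" if "a \<le> x" "x < b" for x
    using that pos_eq_iff[of \<sigma> x b] permsD[OF s] ab by auto
  show ?thesis
  proof (rule subrelI)
    fix y x assume "(y, x) \<in> arc_inversions \<alpha>"
    then have yx: "y = b \<or> a < y \<and> y < b \<and> pos \<sigma> y < pos \<sigma> b" "a \<le> x" "x < b" "x < y"
      "x = a \<or> pos \<sigma> b \<le> pos \<sigma> x"
      unfolding \<alpha> by auto
    then show "(y, x) \<in> inversions \<sigma>"
      unfolding inversions_iff_pos[OF s] using ab eq[of x] by auto
  qed
qed

text \<open>Given an inversion \<open>(y, x)\<close>, take the last letter \<open>w \<ge> y\<close> before \<open>x\<close> and its successor \<open>z < y\<close>. If
  \<open>z \<le> x\<close>, then the descent \<open>w, z\<close> has an arc that inverts \<open>(y, x)\<close>. Otherwise \<open>z\<close> lies between \<open>x\<close> and \<open>y\<close>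
  both in value and in position, and induction applies to \<open>(y, z)\<close> and \<open>(z, x)\<close>.\<close>

lemma inversions_eq_trancl_delta_down:
  assumes s: "\<sigma> \<in> perms n"
  shows "inversions \<sigma> = (\<Union>\<alpha>\<in>delta_down \<sigma>. arc_inversions \<alpha>)\<^sup>+"
proof
  have d: "distinct \<sigma>" and st: "set \<sigma> = {1..n}" and l: "length \<sigma> = n" using permsD[OF s] by auto
  let ?U = "\<Union>\<alpha>\<in>delta_down \<sigma>. arc_inversions \<alpha>"
  show "?U\<^sup>+ \<subseteq> inversions \<sigma>"
    by (rule trancl_union_least[OF biclosed_inversions[OF s]]) (use arc_inversions_delta_down[OF s] in blast)
  have "(y, x) \<in> ?U\<^sup>+" if "(y, x) \<in> inversions \<sigma>" for y x
    using that
  proof (induction "pos \<sigma> x - pos \<sigma> y" arbitrary: x y rule: less_induct)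
    case less
    then have yx: "1 \<le> x" "x < y" "y \<le> n" "pos \<sigma> y < pos \<sigma> x"
      unfolding inversions_iff_pos[OF s] by auto
    let ?I = "{i. i < pos \<sigma> x \<and> y \<le> \<sigma> ! i}"
    define i where "i = Max ?I"
    have np: "\<sigma> ! pos \<sigma> v = v" "pos \<sigma> v < n" if "1 \<le> v" "v \<le> n" for v
      using nth_pos[OF d, of v] that st l by auto
    have yI: "pos \<sigma> y \<in> ?I" using yx np[of y] by auto
    have "i \<in> ?I" unfolding i_def by (rule Max_in) (use yI in auto)
    have iy: "pos \<sigma> y \<le> i" unfolding i_def by (rule Max_ge) (use yI in auto)
    have si: "Suc i < n" using \<open>i \<in> ?I\<close> np[of x] yx by auto
    have less_y: "\<sigma> ! Suc i < y"
    proof (cases "Suc i = pos \<sigma> x")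
      case True then show ?thesis using np[of x] yx by auto
    next
      case False
      have "Suc i \<notin> ?I"
      proof
        assume "Suc i \<in> ?I"
        then have "Suc i \<le> i" unfolding i_def by (intro Max_ge) auto
        then show False by simp
      qed
      then show ?thesis using False \<open>i \<in> ?I\<close> by auto
    qed
    define w z where "w = \<sigma> ! i" and "z = \<sigma> ! Suc i"
    have wz: "1 \<le> z" "w \<le> n" "z < y" "y \<le> w" "pos \<sigma> w = i" "pos \<sigma> z = Suc i"
      using less_y \<open>i \<in> ?I\<close> st l si nth_mem[of i \<sigma>] nth_mem[of "Suc i" \<sigma>] pos_nth[OF d]
      unfolding w_def z_def by auto
    show ?case
    proof (cases "z \<le> x")
      case True
      have "(z, w, n, {v \<in> {z<..<w}. pos \<sigma> v < pos \<sigma> w}) \<in> delta_down \<sigma>"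
        unfolding delta_down_pos[OF s] using wz by auto
      moreover have "y = w \<or> pos \<sigma> y < i"
        using iy pos_eq_iff[OF d, of y w] st wz yx by auto
      then have "(y, x) \<in> arc_inversions (z, w, n, {v \<in> {z<..<w}. pos \<sigma> v < pos \<sigma> w})"
        using True wz yx \<open>i \<in> ?I\<close> by auto
      ultimately show ?thesis by blast
    next
      case False
      then have "pos \<sigma> z \<noteq> pos \<sigma> x" using pos_eq_iff[OF d, of z x] st wz yx by auto
      then have "pos \<sigma> z < pos \<sigma> x" using wz \<open>i \<in> ?I\<close> by auto
      then have "(y, z) \<in> inversions \<sigma>" "pos \<sigma> z - pos \<sigma> y < pos \<sigma> x - pos \<sigma> y"
        "(z, x) \<in> inversions \<sigma>" "pos \<sigma> x - pos \<sigma> z < pos \<sigma> x - pos \<sigma> y"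
        using wz yx iy False by (simp_all add: inversions_iff_pos[OF s])
      then show ?thesis using less.hyps trancl_trans by metis
    qed
  qed
  then show "inversions \<sigma> \<subseteq> ?U\<^sup>+" by (rule subrelI)
qed

lemma delta_down_inj:
  assumes "\<sigma> \<in> perms n" "\<tau> \<in> perms n" "delta_down \<sigma> = delta_down \<tau>"
  shows "\<sigma> = \<tau>"
proof (rule inversions_inj[OF assms(1,2)])
  have "inversions \<sigma> = (\<Union>\<alpha>\<in>delta_down \<sigma>. arc_inversions \<alpha>)\<^sup>+"
    by (rule inversions_eq_trancl_delta_down[OF assms(1)])
  also have "\<dots> = inversions \<tau>"
    unfolding assms(3) by (rule inversions_eq_trancl_delta_down[OF assms(2), symmetric])
  finally show "inversions \<sigma> = inversions \<tau>" .
qed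

text \<open>A crossing of the arcs of the descents \<open>b, a\<close> and \<open>d, c\<close> yields points \<open>r\<close> and \<open>t\<close> with
  \<open>d \<le> r \<le> a\<close> and \<open>b \<le> t \<le> c\<close> in the order of the word. Since descents occupy adjacent positions, this
  forces \<open>b = t = c\<close> or \<open>d = r = a\<close>, a common endpoint, which the definition of a crossing excludes.\<close>

lemma noncrossing_delta_down:
  assumes s: "\<sigma> \<in> perms n"
  shows "noncrossing_arc_diagram n (delta_down \<sigma>)"
  unfolding noncrossing_arc_diagram_def
proof (intro conjI ballI impI)
  have eq: "pos \<sigma> u = pos \<sigma> v \<longleftrightarrow> u = v" if "1 \<le> u" "u \<le> n" "1 \<le> v" "v \<le> n" for u v
    using that pos_eq_iff[of \<sigma> u v] permsD[OF s] by auto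
  show "delta_down \<sigma> \<subseteq> arcs n" by (rule delta_down_subset_arcs[OF s])
  fix \<alpha> \<beta> assume "\<alpha> \<in> delta_down \<sigma>" "\<beta> \<in> delta_down \<sigma>" and ne: "\<alpha> \<noteq> \<beta>"
  obtain a b where \<alpha>: "\<alpha> = (a, b, n, {v \<in> {a<..<b}. pos \<sigma> v < pos \<sigma> b})"
    and ab: "1 \<le> a" "a < b" "b \<le> n" "pos \<sigma> a = Suc (pos \<sigma> b)"
    using delta_downE[OF s \<open>\<alpha> \<in> delta_down \<sigma>\<close>] .
  obtain c d where \<beta>: "\<beta> = (c, d, n, {v \<in> {c<..<d}. pos \<sigma> v < pos \<sigma> d})"
    and cd: "1 \<le> c" "c < d" "d \<le> n" "pos \<sigma> c = Suc (pos \<sigma> d)"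
    using delta_downE[OF s \<open>\<beta> \<in> delta_down \<sigma>\<close>] .
  have "b \<noteq> d" using ne \<alpha> \<beta> ab cd eq[of a c] by auto
  have "a \<noteq> c" using \<open>b \<noteq> d\<close> ab cd eq[of b d] by auto
  show "left_end \<alpha> \<noteq> left_end \<beta>" "right_end \<alpha> \<noteq> right_end \<beta>"
    using \<open>a \<noteq> c\<close> \<open>b \<noteq> d\<close> by (auto simp: left_end_def right_end_def \<alpha> \<beta>)
  show "\<not> cross \<alpha> \<beta>"
  proof
    assume "cross \<alpha> \<beta>"
    then obtain r t where
      rs: "r \<in> {a..b} \<inter> {c..d}" "r \<notin> {a, b} \<inter> {c, d}"
        "t \<in> {a..b} \<inter> {c..d}" "t \<notin> {a, b} \<inter> {c, d}"
      and r: "r \<in> {v \<in> {a<..<b}. pos \<sigma> v < pos \<sigma> b} \<union> {a, b}" "r \<notin> {v \<in> {c<..<d}. pos \<sigma> v < pos \<sigma> d}"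
      and t: "t \<in> {v \<in> {c<..<d}. pos \<sigma> v < pos \<sigma> d} \<union> {c, d}" "t \<notin> {v \<in> {a<..<b}. pos \<sigma> v < pos \<sigma> b}"
      unfolding \<alpha> \<beta> cross.simps by blast
    have r': "pos \<sigma> r \<le> pos \<sigma> a" using r(1) ab by auto
    have t': "pos \<sigma> t \<le> pos \<sigma> c" using t(1) cd by auto
    have r'': "pos \<sigma> d \<le> pos \<sigma> r" using r(2) rs(1) cd(4) by (cases "r \<in> {c, d}") auto
    have t'': "pos \<sigma> b \<le> pos \<sigma> t" using t(2) rs(3) ab(4) by (cases "t \<in> {a, b}") auto
    have "pos \<sigma> b = pos \<sigma> c \<or> pos \<sigma> d = pos \<sigma> a"
      using r' t' r'' t'' ab cd \<open>b \<noteq> d\<close> eq[of b d] by auto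
    then show False
    proof
      assume "pos \<sigma> b = pos \<sigma> c"
      moreover from this have "pos \<sigma> b = pos \<sigma> t" using t' t'' by linarith
      moreover have "1 \<le> t" "t \<le> n" "1 \<le> b" "c \<le> n" using rs(3) ab cd by auto
      ultimately have "b = c" "b = t" using eq ab(3) cd(1) by blast+
      then show False using rs(4) by blast
    next
      assume "pos \<sigma> d = pos \<sigma> a"
      moreover from this have "pos \<sigma> a = pos \<sigma> r" using r' r'' by linarith
      moreover have "1 \<le> r" "r \<le> n" "1 \<le> d" "a \<le> n" using rs(1) ab cd by auto
      ultimately have "d = a" "a = r" using eq ab(1) cd(3) by blast+
      then show False using rs(2) by blast
    qed
  qed
qed

section \<open>Lattice congruences and arc ideals\<close>

lemma arc_perm_obtain:
  assumes "\<alpha> \<in> arcs n"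
  obtains \<sigma> where "\<sigma> \<in> perms n" "inversions \<sigma> = arc_inversions \<alpha>"
  using biclosed_obtain_perm[OF biclosed_arc_inversions[OF assms]] .

text \<open>If \<open>d, c\<close> is a descent, then \<open>d\<close> is in \<open>S \<union> {b}\<close> and \<open>c\<close> is not. All of \<open>S\<close> precedes \<open>b\<close> and
  \<open>]a, b[ - S\<close> follows \<open>a\<close>, so adjacency of \<open>d\<close> and \<open>c\<close> forces \<open>(d, c) = (b, a)\<close>.\<close>

lemma delta_down_arc_perm:
  assumes s: "\<sigma> \<in> perms n" and \<alpha>: "\<alpha> \<in> arcs n" and inv: "inversions \<sigma> = arc_inversions \<alpha>"
  shows "delta_down \<sigma> = {\<alpha>}"
proof -
  obtain a b m S where \<alpha>_eq: "\<alpha> = (a, b, m, S)" by (cases \<alpha>)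
  then have ab: "m = n" "1 \<le> a" "a < b" "b \<le> n" "S \<subseteq> {a<..<b}" using \<alpha> by (auto simp: arcs_iff)
  have before: "pos \<sigma> y < pos \<sigma> x \<longleftrightarrow> y \<in> insert b S \<and> x \<notin> S"
    if "a \<le> x" "x < y" "y \<le> b" for x y
  proof -
    have "(y, x) \<in> inversions \<sigma> \<longleftrightarrow> (y, x) \<in> arc_inversions \<alpha>" using inv by simp
    then show ?thesis using that ab unfolding \<alpha>_eq by (simp add: inversions_iff_pos[OF s])
  qed
  have eq: "pos \<sigma> u = pos \<sigma> v \<longleftrightarrow> u = v" if "1 \<le> u" "u \<le> n" "1 \<le> v" "v \<le> n" for u v
    using that pos_eq_iff[of \<sigma> u v] permsD[OF s] by auto
  have "\<beta> = \<alpha>" if \<beta>: "\<beta> \<in> delta_down \<sigma>" for \<beta>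
  proof -
    have sub: "arc_inversions \<beta> \<subseteq> arc_inversions \<alpha>"
      using arc_inversions_delta_down[OF s \<beta>] inv by simp
    have \<beta>a: "\<beta> \<in> arcs n" using delta_down_subset_arcs[OF s] \<beta> by blast
    obtain c d T where \<beta>_eq: "\<beta> = (c, d, n, T)" and cd: "c < d" "pos \<sigma> c = Suc (pos \<sigma> d)"
      using \<beta> unfolding delta_down_pos[OF s] by auto
    have dc: "d \<in> insert b S" "c \<in> {a..<b} - S"
      using arc_inversions_endpoints[of c d n T n] \<beta>a sub unfolding \<beta>_eq \<alpha>_eq by auto
    have "d = b"
    proof (rule ccontr)
      assume "d \<noteq> b"
      then have "d \<in> S" using dc by auto
      then have "\<not> pos \<sigma> b < pos \<sigma> d" "pos \<sigma> b < pos \<sigma> c"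
        using before[of d b] before[of c b] dc ab by auto
      then show False using cd eq[of b d] \<open>d \<noteq> b\<close> \<open>d \<in> S\<close> ab by auto
    qed
    moreover have "c = a"
    proof (rule ccontr)
      assume "c \<noteq> a"
      then have "\<not> pos \<sigma> c < pos \<sigma> a" "pos \<sigma> d < pos \<sigma> a"
        using before[of a c] before[of a d] dc ab \<open>d = b\<close> by auto
      then show False using cd eq[of a c] \<open>c \<noteq> a\<close> dc ab by auto
    qed
    ultimately have "(b, a) \<in> arc_inversions \<beta>"
      using arc_inversions_endpoints \<beta>a unfolding \<beta>_eq by blast
    then have "arc_inversions \<beta> = arc_inversions \<alpha>"
      using arc_inversions_lower_cover[OF biclosed_arc_inversions[OF \<beta>a]] \<alpha> sub unfolding \<alpha>_eq by blast
    then show ?thesis using arc_inversions_inj \<beta>a \<alpha> by blast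
  qed
  moreover have "delta_down \<sigma> \<noteq> {}"
  proof
    assume "delta_down \<sigma> = {}"
    then have "inversions \<sigma> = {}" using inversions_eq_trancl_delta_down[OF s] by simp
    then show False using inv arc_inversions_endpoints[of a b m S n] \<alpha> unfolding \<alpha>_eq by auto
  qed
  ultimately show ?thesis by blast
qed

lemma single_descent_iff:
  assumes s: "\<sigma> \<in> perms n"
  shows "(\<exists>i. {j. descent \<sigma> j} = {i} \<and> alpha_down i \<sigma> = \<alpha>) \<longleftrightarrow>
    \<alpha> \<in> arcs n \<and> inversions \<sigma> = arc_inversions \<alpha>"
proof
  assume "\<exists>i. {j. descent \<sigma> j} = {i} \<and> alpha_down i \<sigma> = \<alpha>"
  then obtain i where i: "{j. descent \<sigma> j} = {i}" "alpha_down i \<sigma> = \<alpha>" by blast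
  have "delta_down \<sigma> = (\<lambda>i. alpha_down i \<sigma>) ` {j. descent \<sigma> j}"
    unfolding delta_down_def by blast
  then have "delta_down \<sigma> = {\<alpha>}" unfolding i(1) using i(2) by simp
  moreover from this have \<alpha>: "\<alpha> \<in> arcs n" using delta_down_subset_arcs[OF s] by blast
  ultimately show "\<alpha> \<in> arcs n \<and> inversions \<sigma> = arc_inversions \<alpha>"
    using inversions_eq_trancl_delta_down[OF s]
      trancl_id[OF biclosed_trans[OF biclosed_arc_inversions[OF \<alpha>]]] by simp
next
  assume "\<alpha> \<in> arcs n \<and> inversions \<sigma> = arc_inversions \<alpha>"
  then have \<delta>: "delta_down \<sigma> = {\<alpha>}" using delta_down_arc_perm[OF s] by blast
  then obtain i where i: "descent \<sigma> i" "alpha_down i \<sigma> = \<alpha>" unfolding delta_down_def by blast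
  have "j = i" if "descent \<sigma> j" for j
  proof -
    have "alpha_down j \<sigma> = alpha_down i \<sigma>" using that \<delta> i(2) unfolding delta_down_def by blast
    then have "\<sigma> ! (j - 1) = \<sigma> ! (i - 1)" unfolding alpha_down_def entry_def by simp
    moreover have b: "1 \<le> i" "i < length \<sigma>" "1 \<le> j" "j < length \<sigma>"
      using i(1) that unfolding descent_def by auto
    then have "j - 1 < length \<sigma>" "i - 1 < length \<sigma>" by linarith+
    ultimately have "j - 1 = i - 1" using permsD[OF s] nth_eq_iff_index_eq by blast
    then show ?thesis using b by linarith
  qed
  then show "\<exists>i. {j. descent \<sigma> j} = {i} \<and> alpha_down i \<sigma> = \<alpha>" using i by blast
qed

text \<open>Replaces the single-descent permutations by the join-irreducible inversion sets.\<close>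

lemma congruence_arcs_eq:
  "congruence_arcs n C = {\<alpha> \<in> arcs n. \<exists>\<sigma>\<in>perms n. inversions \<sigma> = arc_inversions \<alpha> \<and> pi_down n C \<sigma> = \<sigma>}"
  (is "_ = ?A")
proof -
  have "\<alpha> \<in> congruence_arcs n C \<longleftrightarrow>
    (\<exists>\<sigma>\<in>perms n. pi_down n C \<sigma> = \<sigma> \<and> (\<exists>i. {j. descent \<sigma> j} = {i} \<and> alpha_down i \<sigma> = \<alpha>))" for \<alpha>
    unfolding congruence_arcs_def by blast
  also have "\<dots> \<alpha> \<longleftrightarrow> \<alpha> \<in> ?A" for \<alpha>
    using single_descent_iff by (simp add: conj_commute) metis
  finally show ?thesis by blast
qed

lemma weak_congruence_perms:
  "weak_congruence n C \<Longrightarrow> (\<sigma>, \<tau>) \<in> C \<Longrightarrow> \<sigma> \<in> perms n \<and> \<tau> \<in> perms n"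
  unfolding weak_congruence_def equiv_def by blast

lemma weak_congruence_refl: "weak_congruence n C \<Longrightarrow> \<sigma> \<in> perms n \<Longrightarrow> (\<sigma>, \<sigma>) \<in> C"
  unfolding weak_congruence_def equiv_def refl_on_def by blast

lemma weak_congruence_sym: "weak_congruence n C \<Longrightarrow> (\<sigma>, \<tau>) \<in> C \<Longrightarrow> (\<tau>, \<sigma>) \<in> C"
  unfolding weak_congruence_def equiv_def sym_def by blast

lemma weak_congruence_trans:
  "weak_congruence n C \<Longrightarrow> (\<sigma>, \<tau>) \<in> C \<Longrightarrow> (\<tau>, \<rho>) \<in> C \<Longrightarrow> (\<sigma>, \<rho>) \<in> C"
  unfolding weak_congruence_def equiv_def trans_def by blast

lemma weak_congruence_join:
  "weak_congruence n C \<Longrightarrow> (\<sigma>, \<sigma>') \<in> C \<Longrightarrow> (\<tau>, \<tau>') \<in> C \<Longrightarrow>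
    (\<sigma> \<squnion>\<^bsub>weak_order n\<^esub> \<tau>, \<sigma>' \<squnion>\<^bsub>weak_order n\<^esub> \<tau>') \<in> C"
  unfolding weak_congruence_def by blast

lemma weak_congruence_meet:
  "weak_congruence n C \<Longrightarrow> (\<sigma>, \<sigma>') \<in> C \<Longrightarrow> (\<tau>, \<tau>') \<in> C \<Longrightarrow>
    (\<sigma> \<sqinter>\<^bsub>weak_order n\<^esub> \<tau>, \<sigma>' \<sqinter>\<^bsub>weak_order n\<^esub> \<tau>') \<in> C"
  unfolding weak_congruence_def by blast

lemma weak_order_meet_le:
  assumes "\<sigma> \<in> perms n" "\<tau> \<in> perms n"
  shows "inversions (\<sigma> \<sqinter>\<^bsub>weak_order n\<^esub> \<tau>) \<subseteq> inversions \<sigma>"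
    "inversions (\<sigma> \<sqinter>\<^bsub>weak_order n\<^esub> \<tau>) \<subseteq> inversions \<tau>"
  using weak_order_meet[OF assms] by blast+

lemma weak_order_meet_absorb:
  assumes "\<sigma> \<in> perms n" "\<tau> \<in> perms n" "inversions \<sigma> \<subseteq> inversions \<tau>"
  shows "\<sigma> \<sqinter>\<^bsub>weak_order n\<^esub> \<tau> = \<sigma>"
  using weak_order_meet[OF assms(1,2)] assms by (intro inversions_inj[of _ n]) auto

lemma weak_order_join_absorb:
  assumes "\<sigma> \<in> perms n" "\<tau> \<in> perms n" "inversions \<sigma> \<subseteq> inversions \<tau>"
  shows "\<sigma> \<squnion>\<^bsub>weak_order n\<^esub> \<tau> = \<tau>"
  using weak_order_join[OF assms(1,2)] assms trancl_id[OF biclosed_trans[OF biclosed_inversions[OF assms(2)]]]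
  by (intro inversions_inj[of _ n]) (auto simp: Un_absorb1)

definition class_minimal :: "nat \<Rightarrow> (nat list \<times> nat list) set \<Rightarrow> nat list \<Rightarrow> bool" where
  "class_minimal n C \<sigma> \<longleftrightarrow> \<sigma> \<in> perms n \<and> (\<forall>\<tau>. (\<sigma>, \<tau>) \<in> C \<longrightarrow> inversions \<sigma> \<subseteq> inversions \<tau>)"

lemma finite_inversions: "\<sigma> \<in> perms n \<Longrightarrow> finite (inversions \<sigma>)"
  by (rule finite_subset[of _ "{1..n} \<times> {1..n}"]) (auto simp: inversions_iff_pos)

text \<open>A class is closed under meets, so a member with the fewest inversions lies below all others.\<close>

lemma pi_down_least:
  assumes C: "weak_congruence n C" and s: "\<sigma> \<in> perms n"
  shows "least (weak_order n) (pi_down n C \<sigma>) (C `` {\<sigma>})"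
proof -
  obtain m where m: "(\<sigma>, m) \<in> C" "\<And>\<tau>. (\<sigma>, \<tau>) \<in> C \<Longrightarrow> card (inversions m) \<le> card (inversions \<tau>)"
    using ex_has_least_nat[of "\<lambda>\<tau>. (\<sigma>, \<tau>) \<in> C" \<sigma> "\<lambda>\<tau>. card (inversions \<tau>)"]
      weak_congruence_refl[OF C s] by blast
  note p = weak_congruence_perms[OF C]
  have mp: "m \<in> perms n" using p[OF m(1)] by blast
  have "inversions m \<subseteq> inversions \<tau>" if \<tau>: "(\<sigma>, \<tau>) \<in> C" for \<tau>
  proof -
    let ?k = "m \<sqinter>\<^bsub>weak_order n\<^esub> \<tau>"
    have tp: "\<tau> \<in> perms n" using p[OF \<tau>] by blast
    have "(\<sigma>, ?k) \<in> C"
      using weak_congruence_meet[OF C m(1) \<tau>] weak_order_meet_absorb[OF s s subset_refl] by simp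
    then have "inversions ?k = inversions m"
      using weak_order_meet_le(1)[OF mp tp] card_seteq[OF finite_inversions[OF mp]] m(2) by blast
    then show ?thesis using weak_order_meet_le(2)[OF mp tp] by simp
  qed
  then have l: "least (weak_order n) m (C `` {\<sigma>})"
    using m(1) p unfolding least_def by auto
  show ?thesis
    unfolding pi_down_def
    by (rule theI[where P = "\<lambda>\<tau>. least (weak_order n) \<tau> (C `` {\<sigma>})", OF l])
      (rule weak_order_least_unique[OF _ l])
qed

lemma pi_down_in_class:
  assumes "weak_congruence n C" "\<sigma> \<in> perms n"
  shows "(\<sigma>, pi_down n C \<sigma>) \<in> C"
  using pi_down_least[OF assms] unfolding least_def by blast

lemma class_minimal_pi_down:
  assumes C: "weak_congruence n C" and s: "\<sigma> \<in> perms n"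
  shows "class_minimal n C (pi_down n C \<sigma>)"
proof -
  note in_class = pi_down_in_class[OF C s]
  then have "(\<sigma>, \<tau>) \<in> C" if "(pi_down n C \<sigma>, \<tau>) \<in> C" for \<tau>
    using weak_congruence_trans[OF C] that by blast
  then show ?thesis
    using pi_down_least[OF C s] weak_congruence_perms[OF C in_class]
    unfolding least_def class_minimal_def by auto
qed

lemma pi_down_eq_self_iff:
  assumes C: "weak_congruence n C" and s: "\<sigma> \<in> perms n"
  shows "pi_down n C \<sigma> = \<sigma> \<longleftrightarrow> class_minimal n C \<sigma>"
proof
  assume m: "class_minimal n C \<sigma>"
  have "inversions \<sigma> \<subseteq> inversions (pi_down n C \<sigma>)"
    using m pi_down_in_class[OF C s] unfolding class_minimal_def by blast
  moreover have "inversions (pi_down n C \<sigma>) \<subseteq> inversions \<sigma>"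
    using class_minimal_pi_down[OF C s] weak_congruence_sym[OF C pi_down_in_class[OF C s]]
    unfolding class_minimal_def by blast
  ultimately show "pi_down n C \<sigma> = \<sigma>"
    using class_minimal_pi_down[OF C s] s inversions_inj unfolding class_minimal_def by blast
qed (use class_minimal_pi_down[OF C s] in simp)

lemma congruence_arcs_iff:
  assumes C: "weak_congruence n C" and s: "\<sigma> \<in> perms n"
    and \<alpha>: "\<alpha> \<in> arcs n" and inv: "inversions \<sigma> = arc_inversions \<alpha>"
  shows "\<alpha> \<in> congruence_arcs n C \<longleftrightarrow> class_minimal n C \<sigma>"
  unfolding congruence_arcs_eq using \<alpha> s inv pi_down_eq_self_iff[OF C] inversions_inj by blast

definition arcs_below :: "arc set \<Rightarrow> nat list \<Rightarrow> arc set" where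
  "arcs_below I \<sigma> = {\<alpha> \<in> I. arc_inversions \<alpha> \<subseteq> inversions \<sigma>}"

text \<open>If the permutation \<open>l\<close> of the arc is least in its class and lies below \<open>\<sigma>\<close>, then \<open>l = l \<sqinter> \<sigma>\<close> is
  congruent to \<open>l \<sqinter> \<tau>\<close>, so it lies below the latter and hence below \<open>\<tau>\<close>.\<close>

lemma arcs_below_congruent:
  assumes C: "weak_congruence n C" and st: "(\<sigma>, \<tau>) \<in> C"
  shows "arcs_below (congruence_arcs n C) \<sigma> \<subseteq> arcs_below (congruence_arcs n C) \<tau>"
proof
  fix \<alpha> assume "\<alpha> \<in> arcs_below (congruence_arcs n C) \<sigma>"
  then have \<alpha>: "\<alpha> \<in> congruence_arcs n C" and le: "arc_inversions \<alpha> \<subseteq> inversions \<sigma>"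
    unfolding arcs_below_def by auto
  then have \<alpha>': "\<alpha> \<in> arcs n" unfolding congruence_arcs_eq by blast
  then obtain l where l: "l \<in> perms n" "inversions l = arc_inversions \<alpha>"
    using arc_perm_obtain by blast
  have s: "\<sigma> \<in> perms n" and t: "\<tau> \<in> perms n" using weak_congruence_perms[OF C st] by auto
  have "(l, l \<sqinter>\<^bsub>weak_order n\<^esub> \<tau>) \<in> C"
    using weak_congruence_meet[OF C weak_congruence_refl[OF C l(1)] st]
      weak_order_meet_absorb[OF l(1) s] le l(2) by simp
  moreover have "class_minimal n C l" using congruence_arcs_iff[OF C l(1) \<alpha>' l(2)] \<alpha> by simp
  ultimately have "inversions l \<subseteq> inversions (l \<sqinter>\<^bsub>weak_order n\<^esub> \<tau>)"
    unfolding class_minimal_def by blast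
  then show "\<alpha> \<in> arcs_below (congruence_arcs n C) \<tau>"
    using \<alpha> weak_order_meet_le(2)[OF l(1) t] l(2) unfolding arcs_below_def by auto
qed

text \<open>The inversion set after exchanging the two entries of a descent.\<close>

lemma delete_descent:
  assumes s: "\<sigma> \<in> perms n" and "(a, b, m, S) \<in> delta_down \<sigma>"
  shows "biclosed n (inversions \<sigma> - {(b, a)})"
proof -
  have ab: "a < b" "pos \<sigma> a = Suc (pos \<sigma> b)" "1 \<le> a" "b \<le> n"
    using assms(2) unfolding delta_down_pos[OF s] by auto
  have eq: "pos \<sigma> u = pos \<sigma> v \<longleftrightarrow> u = v" if "1 \<le> u" "u \<le> n" "1 \<le> v" "v \<le> n" for u v
    using that pos_eq_iff[of \<sigma> u v] permsD[OF s] by auto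
  show ?thesis
    unfolding biclosed_def
  proof (intro conjI allI impI)
    show "trans (inversions \<sigma> - {(b, a)})"
      by (rule transI) (use ab in \<open>auto simp: inversions_iff_pos[OF s]\<close>)
    fix x y z assume *: "(z, x) \<in> inversions \<sigma> - {(b, a)}" "x < y" "y < z"
    then have "pos \<sigma> x \<noteq> pos \<sigma> y" "pos \<sigma> y \<noteq> pos \<sigma> z"
      using eq[of x y] eq[of y z] by (auto simp: inversions_iff_pos[OF s])
    then show "(z, y) \<in> inversions \<sigma> - {(b, a)} \<or> (y, x) \<in> inversions \<sigma> - {(b, a)}"
      using * ab by (auto simp: inversions_iff_pos[OF s])
  qed (auto simp: inversions_iff_pos[OF s])
qed

text \<open>Let \<open>l\<close> be the permutation of \<open>\<alpha>\<close>, and let \<open>m\<close> become \<open>m'\<close> by exchanging the descent \<open>\<alpha>\<close>. If \<open>l\<close> were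
  congruent to some \<open>k\<close> strictly below it, then \<open>k\<close> would lie below \<open>m'\<close>, so that joining both with \<open>m'\<close>
  makes \<open>m = l \<squnion> m'\<close> congruent to \<open>k \<squnion> m' = m'\<close>, against the minimality of \<open>m\<close>.\<close>

lemma delta_down_class_minimal:
  assumes C: "weak_congruence n C" and m: "class_minimal n C m" and \<alpha>: "\<alpha> \<in> delta_down m"
  shows "\<alpha> \<in> congruence_arcs n C"
proof -
  have mp: "m \<in> perms n" using m unfolding class_minimal_def by blast
  have \<alpha>a: "\<alpha> \<in> arcs n" using \<alpha> delta_down_subset_arcs[OF mp] by blast
  obtain a b k S where \<alpha>_eq: "\<alpha> = (a, b, k, S)" by (cases \<alpha>)
  obtain l where l: "l \<in> perms n" "inversions l = arc_inversions \<alpha>"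
    using arc_perm_obtain[OF \<alpha>a] .
  obtain m' where m': "m' \<in> perms n" "inversions m' = inversions m - {(b, a)}"
    using biclosed_obtain_perm[OF delete_descent[OF mp]] \<alpha> unfolding \<alpha>_eq by metis
  have ba: "(b, a) \<in> arc_inversions \<alpha>" using arc_inversions_endpoints \<alpha>a unfolding \<alpha>_eq by blast
  have lm: "arc_inversions \<alpha> \<subseteq> inversions m" by (rule arc_inversions_delta_down[OF mp \<alpha>])
  have "inversions l \<subseteq> inversions \<mu>" if \<mu>: "(l, \<mu>) \<in> C" for \<mu>
  proof -
    have \<mu>p: "\<mu> \<in> perms n" using weak_congruence_perms[OF C \<mu>] by blast
    let ?k = "l \<sqinter>\<^bsub>weak_order n\<^esub> \<mu>"
    have kp: "?k \<in> perms n" by (rule weak_order_meet(1)[OF l(1) \<mu>p])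
    have lk: "(l, ?k) \<in> C"
      using weak_congruence_meet[OF C weak_congruence_refl[OF C l(1)] \<mu>]
        weak_order_meet_absorb[OF l(1) l(1)] by simp
    have kl: "inversions ?k \<subseteq> arc_inversions \<alpha>" using weak_order_meet_le(1)[OF l(1) \<mu>p] l(2) by simp
    have "(b, a) \<in> inversions ?k"
    proof (rule ccontr)
      assume not_ba: "(b, a) \<notin> inversions ?k"
      have "?k \<squnion>\<^bsub>weak_order n\<^esub> m' = m'"
        by (rule weak_order_join_absorb[OF kp m'(1)]) (use kl lm not_ba m'(2) in auto)
      moreover have "l \<squnion>\<^bsub>weak_order n\<^esub> m' = m"
      proof (rule inversions_inj[of _ n])
        have "arc_inversions \<alpha> \<union> (inversions m - {(b, a)}) = inversions m" using lm ba by auto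
        then show "inversions (l \<squnion>\<^bsub>weak_order n\<^esub> m') = inversions m"
          unfolding weak_order_join(2)[OF l(1) m'(1)] l(2) m'(2)
          using trancl_id[OF biclosed_trans[OF biclosed_inversions[OF mp]]] by simp
      qed (use mp weak_order_join(1)[OF l(1) m'(1)] in auto)
      ultimately have "(m, m') \<in> C"
        using weak_congruence_join[OF C lk weak_congruence_refl[OF C m'(1)]] by simp
      then have "inversions m \<subseteq> inversions m'" using m unfolding class_minimal_def by blast
      then show False using m'(2) ba lm by auto
    qed
    then have "inversions ?k = arc_inversions \<alpha>"
      using arc_inversions_lower_cover[OF biclosed_inversions[OF kp]] \<alpha>a kl unfolding \<alpha>_eq by blast
    then show ?thesis using l(2) weak_order_meet_le(2)[OF l(1) \<mu>p] by simp
  qed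
  then show ?thesis
    using congruence_arcs_iff[OF C l(1) \<alpha>a l(2)] l(1) unfolding class_minimal_def by blast
qed

text \<open>The least element of the class of \<open>\<sigma>\<close> is the join of its descent arcs, which are arcs of the
  congruence below \<open>\<sigma>\<close>. So two permutations above the same arcs of the congruence have the same
  least element in their classes.\<close>

lemma weak_congruence_determined:
  assumes C: "weak_congruence n C"
  shows "(\<sigma>, \<tau>) \<in> C \<longleftrightarrow> \<sigma> \<in> perms n \<and> \<tau> \<in> perms n \<and>
    arcs_below (congruence_arcs n C) \<sigma> = arcs_below (congruence_arcs n C) \<tau>"
proof
  assume "(\<sigma>, \<tau>) \<in> C"
  then show "\<sigma> \<in> perms n \<and> \<tau> \<in> perms n \<and>
    arcs_below (congruence_arcs n C) \<sigma> = arcs_below (congruence_arcs n C) \<tau>"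
    using weak_congruence_perms[OF C] weak_congruence_sym[OF C] arcs_below_congruent[OF C] by blast
next
  let ?I = "congruence_arcs n C" and ?\<pi> = "pi_down n C"
  assume a: "\<sigma> \<in> perms n \<and> \<tau> \<in> perms n \<and> arcs_below ?I \<sigma> = arcs_below ?I \<tau>"
  have below: "inversions (?\<pi> \<rho>) \<subseteq> inversions (?\<pi> \<rho>')"
    if r: "\<rho> \<in> perms n" "\<rho>' \<in> perms n" and eq: "arcs_below ?I \<rho> = arcs_below ?I \<rho>'" for \<rho> \<rho>'
  proof -
    have p: "?\<pi> \<rho> \<in> perms n" "?\<pi> \<rho>' \<in> perms n"
      using class_minimal_pi_down[OF C] r unfolding class_minimal_def by auto
    have "delta_down (?\<pi> \<rho>) \<subseteq> arcs_below ?I (?\<pi> \<rho>)"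
      using delta_down_class_minimal[OF C class_minimal_pi_down[OF C r(1)]]
        arc_inversions_delta_down[OF p(1)] unfolding arcs_below_def by blast
    also have "\<dots> \<subseteq> arcs_below ?I \<rho>"
      by (rule arcs_below_congruent[OF C weak_congruence_sym[OF C pi_down_in_class[OF C r(1)]]])
    also have "\<dots> \<subseteq> arcs_below ?I (?\<pi> \<rho>')"
      unfolding eq by (rule arcs_below_congruent[OF C pi_down_in_class[OF C r(2)]])
    finally have "(\<Union>\<alpha>\<in>delta_down (?\<pi> \<rho>). arc_inversions \<alpha>) \<subseteq> inversions (?\<pi> \<rho>')"
      unfolding arcs_below_def by blast
    then show ?thesis
      unfolding inversions_eq_trancl_delta_down[OF p(1)]
      by (rule trancl_union_least[OF biclosed_inversions[OF p(2)]])
  qed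
  have "?\<pi> \<sigma> = ?\<pi> \<tau>"
    using below[of \<sigma> \<tau>] below[of \<tau> \<sigma>] a class_minimal_pi_down[OF C] inversions_inj
    unfolding class_minimal_def by (metis subset_antisym)
  then show "(\<sigma>, \<tau>) \<in> C"
    using pi_down_in_class[OF C, of \<sigma>] pi_down_in_class[OF C, of \<tau>] a
      weak_congruence_sym[OF C] weak_congruence_trans[OF C] by metis
qed

text \<open>Induction on the length of the arc \<open>(a, b, n, S)\<close>. All its inversions except \<open>(b, a)\<close> already belong to
  proper subarcs, which are in \<open>I\<close>. If \<open>(b, z)\<close> is inverted in the join of \<open>R\<close> and \<open>Q\<close> for some \<open>z\<close> in
  \<open>S\<close>, then for the largest such \<open>z\<close> the subarc from \<open>z\<close> to \<open>b\<close> lies below this join, and \<open>(b, a)\<close> splits at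
  \<open>z\<close>; symmetrically for a \<open>z\<close> outside \<open>S\<close> with \<open>(z, a)\<close> inverted. In the absence of such \<open>z\<close> no
  chain from \<open>b\<close> to \<open>a\<close> has an intermediate point, so \<open>(b, a)\<close> is in \<open>R\<close> or in \<open>Q\<close>; that set
  then contains the whole inversion set of the arc.\<close>

lemma arc_ideal_join:
  assumes I: "arc_ideal n I"
    and R: "biclosed n R" "biclosed n R'" and Q: "biclosed n Q" "biclosed n Q'"
    and RR': "\<And>\<alpha>. \<alpha> \<in> I \<Longrightarrow> arc_inversions \<alpha> \<subseteq> R \<Longrightarrow> arc_inversions \<alpha> \<subseteq> R'"
    and QQ': "\<And>\<alpha>. \<alpha> \<in> I \<Longrightarrow> arc_inversions \<alpha> \<subseteq> Q \<Longrightarrow> arc_inversions \<alpha> \<subseteq> Q'"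
    and "\<alpha> \<in> I" "arc_inversions \<alpha> \<subseteq> (R \<union> Q)\<^sup>+"
  shows "arc_inversions \<alpha> \<subseteq> (R' \<union> Q')\<^sup>+"
proof -
  let ?T = "(R \<union> Q)\<^sup>+" and ?T' = "(R' \<union> Q')\<^sup>+"
  have T: "biclosed n ?T" and T': "biclosed n ?T'" using R Q by (auto intro: biclosed_trancl_union)
  have "arc_inversions (a, b, n, S) \<subseteq> ?T'"
    if "(a, b, n, S) \<in> I" "arc_inversions (a, b, n, S) \<subseteq> ?T" for a b S
    using that
  proof (induction "b - a" arbitrary: a b S rule: less_induct)
    case less
    note \<alpha>I = less.prems(1) and \<alpha>T = less.prems(2)
    have "(a, b, n, S) \<in> arcs n" using I \<alpha>I unfolding arc_ideal_def by blast
    then have ab: "1 \<le> a" "a < b" "b \<le> n" "S \<subseteq> {a<..<b}" "a \<notin> S" by (auto simp: arcs_iff)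
    have sub: "(c, d, n, S \<inter> {c<..<d}) \<in> I" if "a \<le> c" "c < d" "d \<le> b" for c d
      using I \<alpha>I that unfolding arc_ideal_def by blast
    have sub_T': "(d, c) \<in> ?T'"
      if cd: "a \<le> c" "c < d" "d \<le> b" "(c, d) \<noteq> (a, b)"
        and le: "arc_inversions (c, d, n, S \<inter> {c<..<d}) \<subseteq> ?T" for c d
    proof -
      have "d - c < b - a" using cd ab by auto
      then have "arc_inversions (c, d, n, S \<inter> {c<..<d}) \<subseteq> ?T'"
        using less.hyps sub cd le by blast
      then show ?thesis using cd by auto
    qed
    have proper: "(y, x) \<in> ?T'"
      if yx: "(y, x) \<in> arc_inversions (a, b, n, S)" "(y, x) \<noteq> (b, a)" for y x
    proof (rule sub_T')
      have "arc_inversions (x, y, n, S \<inter> {x<..<y}) \<subseteq> arc_inversions (a, b, n, S)"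
        using yx(1) ab by auto
      then show "arc_inversions (x, y, n, S \<inter> {x<..<y}) \<subseteq> ?T" using \<alpha>T by blast
    qed (use yx ab in auto)
    have ba: "(b, a) \<in> ?T" using \<alpha>T ab by auto
    have "arc_inversions (a, b, n, S) \<subseteq> ?T' \<or> (b, a) \<in> ?T'"
    proof -
      let ?Z = "{z \<in> S. (b, z) \<in> ?T}" and ?W = "{z \<in> {a<..<b} - S. (z, a) \<in> ?T}"
      have fin: "finite S" using ab finite_subset by blast
      consider "?Z \<noteq> {}" | "?W \<noteq> {}" | "?Z = {}" "?W = {}" by blast
      then show ?thesis
      proof cases
        case 1
        \<comment> \<open>Maximality of \<open>z\<close> puts \<open>(v, z)\<close> into the join for every larger \<open>v\<close> in \<open>S\<close>.\<close>
        define z where "z = Max ?Z"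
        have "z \<in> ?Z" unfolding z_def by (rule Max_in) (use fin 1 in auto)
        then have z: "z \<in> S" "(b, z) \<in> ?T" "a < z" "z < b" using ab by auto
        have z_max: "(b, y) \<notin> ?T" if "y \<in> S" "z < y" for y
        proof
          assume "(b, y) \<in> ?T"
          then have "y \<le> z" unfolding z_def by (intro Max_ge) (use fin that in auto)
          then show False using that by simp
        qed
        have "(b, z) \<in> ?T'"
        proof (rule sub_T')
          show "arc_inversions (z, b, n, S \<inter> {z<..<b}) \<subseteq> ?T"
          proof (rule subrelI)
            fix v u assume vu: "(v, u) \<in> arc_inversions (z, b, n, S \<inter> {z<..<b})"
            show "(v, u) \<in> ?T"
            proof (cases "u = z")
              case True
              then show ?thesis using vu z z_max[of v] biclosed_cotrans[OF T z(2), of v] by auto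
            next
              case False
              then have "(v, u) \<in> arc_inversions (a, b, n, S)" using vu z by auto
              then show ?thesis using \<alpha>T by blast
            qed
          qed
        qed (use z in auto)
        moreover have "(z, a) \<in> ?T'" using proper[of z a] z ab by auto
        ultimately show ?thesis by (meson trancl_trans)
      next
        case 2
        define z where "z = Min ?W"
        have "z \<in> ?W" unfolding z_def by (rule Min_in) (use 2 in auto)
        then have z: "z \<notin> S" "(z, a) \<in> ?T" "a < z" "z < b" by auto
        have z_min: "(y, a) \<notin> ?T" if "y \<notin> S" "a < y" "y < z" for y
        proof
          assume "(y, a) \<in> ?T"
          then have "z \<le> y" unfolding z_def by (intro Min_le) (use that z in auto)
          then show False using that by simp
        qed
        have "(z, a) \<in> ?T'"
        proof (rule sub_T')
          show "arc_inversions (a, z, n, S \<inter> {a<..<z}) \<subseteq> ?T"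
          proof (rule subrelI)
            fix v u assume vu: "(v, u) \<in> arc_inversions (a, z, n, S \<inter> {a<..<z})"
            show "(v, u) \<in> ?T"
            proof (cases "v = z")
              case True
              then show ?thesis
                using vu z z_min[of u] biclosed_cotrans[OF T z(2), of u] ab by (cases "u = a") auto
            next
              case False
              then have "(v, u) \<in> arc_inversions (a, b, n, S)" using vu z ab by auto
              then show ?thesis using \<alpha>T by blast
            qed
          qed
        qed (use z in auto)
        moreover have "(b, z) \<in> ?T'" using proper[of b z] z ab by auto
        ultimately show ?thesis by (meson trancl_trans)
      next
        case 3
        have "(b, a) \<in> R \<union> Q"
        proof (rule ccontr)
          assume "(b, a) \<notin> R \<union> Q"
          then obtain z where step: "(b, z) \<in> R \<union> Q" "(z, a) \<in> ?T"
            using ba by (meson converse_tranclE)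
          then have "(b, z) \<in> ?T" by blast
          then have "a < z" "z < b"
            using biclosed_bounds[OF T, of z a] biclosed_bounds[OF T, of b z] step(2) by auto
          then show False using 3 step(2) \<open>(b, z) \<in> ?T\<close> by (cases "z \<in> S") auto
        qed
        then consider "(b, a) \<in> R" | "(b, a) \<in> Q" by blast
        then show ?thesis
        proof cases
          case 1
          have "arc_inversions (a, b, n, S) \<subseteq> R"
            by (rule arc_inversions_subset[OF R(1) 1]) (use 3 ab in auto)
          then show ?thesis using RR'[OF \<alpha>I] by auto
        next
          case 2
          have "arc_inversions (a, b, n, S) \<subseteq> Q"
            by (rule arc_inversions_subset[OF Q(1) 2]) (use 3 ab in auto)
          then show ?thesis using QQ'[OF \<alpha>I] by auto
        qed
      qed
    qed
    moreover have "arc_inversions (a, b, n, S) \<subseteq> ?T'" if "(b, a) \<in> ?T'"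
    proof (rule subrelI)
      fix y x assume "(y, x) \<in> arc_inversions (a, b, n, S)"
      then show "(y, x) \<in> ?T'" using proper[of y x] that by (cases "(y, x) = (b, a)") simp_all
    qed
    ultimately show ?case by blast
  qed
  moreover have "\<alpha> \<in> arcs n" using I \<open>\<alpha> \<in> I\<close> unfolding arc_ideal_def by blast
  then obtain a b S where "\<alpha> = (a, b, n, S)" unfolding arcs_def by blast
  ultimately show ?thesis using assms(8,9) by blast
qed

definition arc_equivalence :: "nat \<Rightarrow> arc set \<Rightarrow> (nat list \<times> nat list) set" where
  "arc_equivalence n I =
    {(\<sigma>, \<tau>). \<sigma> \<in> perms n \<and> \<tau> \<in> perms n \<and> arcs_below I \<sigma> = arcs_below I \<tau>}"

text \<open>Being an inversion set, \<open>arc_inversions \<alpha>\<close> lies below a meet iff it lies below both terms.\<close>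

lemma arcs_below_meet:
  assumes "I \<subseteq> arcs n" "\<sigma> \<in> perms n" "\<tau> \<in> perms n"
  shows "arcs_below I (\<sigma> \<sqinter>\<^bsub>weak_order n\<^esub> \<tau>) = arcs_below I \<sigma> \<inter> arcs_below I \<tau>"
proof -
  have "arc_inversions \<alpha> \<subseteq> inversions (\<sigma> \<sqinter>\<^bsub>weak_order n\<^esub> \<tau>) \<longleftrightarrow>
    arc_inversions \<alpha> \<subseteq> inversions \<sigma> \<and> arc_inversions \<alpha> \<subseteq> inversions \<tau>" if "\<alpha> \<in> I" for \<alpha>
    using arc_perm_obtain[of \<alpha> n] weak_order_meet(2)[OF assms(2,3)] that assms(1) by (metis subsetD)
  then show ?thesis unfolding arcs_below_def by blast
qed

lemma weak_congruence_arc_equivalence: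
  assumes I: "arc_ideal n I"
  shows "weak_congruence n (arc_equivalence n I)"
  unfolding weak_congruence_def
proof (intro conjI allI impI)
  show "equiv (perms n) (arc_equivalence n I)"
    unfolding equiv_def refl_on_def sym_def trans_def arc_equivalence_def by auto
  fix \<sigma> \<sigma>' \<tau> \<tau>'
  assume "(\<sigma>, \<sigma>') \<in> arc_equivalence n I" "(\<tau>, \<tau>') \<in> arc_equivalence n I"
  then have p: "\<sigma> \<in> perms n" "\<sigma>' \<in> perms n" "\<tau> \<in> perms n" "\<tau>' \<in> perms n"
    and eq: "arcs_below I \<sigma> = arcs_below I \<sigma>'" "arcs_below I \<tau> = arcs_below I \<tau>'"
    unfolding arc_equivalence_def by auto
  show "(\<sigma> \<sqinter>\<^bsub>weak_order n\<^esub> \<tau>, \<sigma>' \<sqinter>\<^bsub>weak_order n\<^esub> \<tau>') \<in> arc_equivalence n I"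
    using I p eq weak_order_meet(1) arcs_below_meet unfolding arc_ideal_def arc_equivalence_def by auto
  have "arcs_below I (\<sigma> \<squnion>\<^bsub>weak_order n\<^esub> \<tau>) \<subseteq> arcs_below I (\<sigma>' \<squnion>\<^bsub>weak_order n\<^esub> \<tau>')"
    if p: "\<sigma> \<in> perms n" "\<sigma>' \<in> perms n" "\<tau> \<in> perms n" "\<tau>' \<in> perms n"
      and eq: "arcs_below I \<sigma> = arcs_below I \<sigma>'" "arcs_below I \<tau> = arcs_below I \<tau>'" for \<sigma> \<sigma>' \<tau> \<tau>'
  proof
    fix \<alpha> assume "\<alpha> \<in> arcs_below I (\<sigma> \<squnion>\<^bsub>weak_order n\<^esub> \<tau>)"
    then have \<alpha>: "\<alpha> \<in> I" "arc_inversions \<alpha> \<subseteq> (inversions \<sigma> \<union> inversions \<tau>)\<^sup>+"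
      using weak_order_join(2) p unfolding arcs_below_def by auto
    have below: "\<beta> \<in> I \<Longrightarrow> arc_inversions \<beta> \<subseteq> inversions \<sigma> \<Longrightarrow> arc_inversions \<beta> \<subseteq> inversions \<sigma>'"
      "\<beta> \<in> I \<Longrightarrow> arc_inversions \<beta> \<subseteq> inversions \<tau> \<Longrightarrow> arc_inversions \<beta> \<subseteq> inversions \<tau>'" for \<beta>
      using eq unfolding arcs_below_def by blast+
    have "arc_inversions \<alpha> \<subseteq> (inversions \<sigma>' \<union> inversions \<tau>')\<^sup>+"
      by (rule arc_ideal_join[OF I p(1,2,3,4)[THEN biclosed_inversions] below \<alpha>])
    then show "\<alpha> \<in> arcs_below I (\<sigma>' \<squnion>\<^bsub>weak_order n\<^esub> \<tau>')"
      using \<alpha>(1) weak_order_join(2) p unfolding arcs_below_def by auto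
  qed
  from this[OF p eq] this[OF p(2,1,4,3) eq(1)[symmetric] eq(2)[symmetric]]
  show "(\<sigma> \<squnion>\<^bsub>weak_order n\<^esub> \<tau>, \<sigma>' \<squnion>\<^bsub>weak_order n\<^esub> \<tau>') \<in> arc_equivalence n I"
    using p weak_order_join(1) unfolding arc_equivalence_def by auto
qed

text \<open>If \<open>\<alpha>\<close> is not in \<open>I\<close>, then no arc of \<open>I\<close> separates its permutation \<open>l\<close> from the lower cover \<open>l'\<close>: such
  an arc lies below \<open>l\<close> and inverts \<open>(b, a)\<close>, hence equals \<open>\<alpha>\<close>.\<close>

lemma congruence_arcs_arc_equivalence:
  assumes I: "arc_ideal n I"
  shows "congruence_arcs n (arc_equivalence n I) = I"
proof -
  let ?C = "arc_equivalence n I"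
  have C: "weak_congruence n ?C" by (rule weak_congruence_arc_equivalence[OF I])
  have Ia: "I \<subseteq> arcs n" using I unfolding arc_ideal_def by blast
  have "\<alpha> \<in> congruence_arcs n ?C \<longleftrightarrow> \<alpha> \<in> I" if \<alpha>: "\<alpha> \<in> arcs n" for \<alpha>
  proof -
    obtain l where l: "l \<in> perms n" "inversions l = arc_inversions \<alpha>"
      using arc_perm_obtain[OF \<alpha>] .
    have "class_minimal n ?C l \<longleftrightarrow> \<alpha> \<in> I"
    proof
      assume "\<alpha> \<in> I"
      then have "\<alpha> \<in> arcs_below I l" unfolding arcs_below_def using l(2) by auto
      then show "class_minimal n ?C l"
        unfolding class_minimal_def arc_equivalence_def using l by (auto simp: arcs_below_def)
    next
      assume m: "class_minimal n ?C l"
      obtain a b k S where \<alpha>_eq: "\<alpha> = (a, b, k, S)" by (cases \<alpha>)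
      have \<delta>: "(a, b, k, S) \<in> delta_down l" using delta_down_arc_perm[OF l(1) \<alpha> l(2)] \<alpha>_eq by simp
      obtain l' where l': "l' \<in> perms n" "inversions l' = inversions l - {(b, a)}"
        using biclosed_obtain_perm[OF delete_descent[OF l(1) \<delta>]] .
      have "(b, a) \<in> inversions l"
        using arc_inversions_endpoints \<alpha> l(2) unfolding \<alpha>_eq by blast
      then have "(l, l') \<notin> ?C" using m l'(2) unfolding class_minimal_def by blast
      then obtain \<beta> where \<beta>: "\<beta> \<in> I" "arc_inversions \<beta> \<subseteq> inversions l" "\<not> arc_inversions \<beta> \<subseteq> inversions l'"
        using l(1) l' unfolding arc_equivalence_def arcs_below_def by blast
      have \<beta>a: "\<beta> \<in> arcs n" using \<beta>(1) Ia by blast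
      have "(b, a) \<in> arc_inversions \<beta>" using \<beta>(2,3) l'(2) by auto
      then have "arc_inversions \<beta> = arc_inversions \<alpha>"
        using arc_inversions_lower_cover[OF biclosed_arc_inversions[OF \<beta>a]] \<alpha> \<beta>(2) l(2)
        unfolding \<alpha>_eq by blast
      then show "\<alpha> \<in> I" using arc_inversions_inj \<beta>a \<alpha> \<beta>(1) by blast
    qed
    then show ?thesis using congruence_arcs_iff[OF C l(1) \<alpha> l(2)] by simp
  qed
  then show ?thesis using Ia congruence_arcs_eq by blast
qed

lemma arc_congruence_eq:
  assumes I: "arc_ideal n I"
  shows "arc_congruence n I = arc_equivalence n I"
  unfolding arc_congruence_def
proof (rule the_equality)
  show "weak_congruence n (arc_equivalence n I) \<and> congruence_arcs n (arc_equivalence n I) = I"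
    using weak_congruence_arc_equivalence congruence_arcs_arc_equivalence I by blast
  fix C assume "weak_congruence n C \<and> congruence_arcs n C = I"
  then show "C = arc_equivalence n I"
    using weak_congruence_determined[of n C] unfolding arc_equivalence_def by auto
qed

text \<open>Descent arcs determine a permutation, so the fibres of \<open>eta_down\<close> are the congruence classes.\<close>

lemma eta_down_eq_iff:
  assumes I: "arc_ideal n I" and p: "\<sigma> \<in> perms n" "\<tau> \<in> perms n"
  shows "eta_down n I \<sigma> = eta_down n I \<tau> \<longleftrightarrow> arcs_below I \<sigma> = arcs_below I \<tau>"
proof -
  let ?C = "arc_equivalence n I"
  have C: "weak_congruence n ?C" by (rule weak_congruence_arc_equivalence[OF I])
  note m = class_minimal_pi_down[OF C p(1)] class_minimal_pi_down[OF C p(2)]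
  have "eta_down n I \<sigma> = eta_down n I \<tau> \<longleftrightarrow> pi_down n ?C \<sigma> = pi_down n ?C \<tau>"
    unfolding eta_down_def arc_congruence_eq[OF I]
    using m delta_down_inj unfolding class_minimal_def by metis
  also have "\<dots> \<longleftrightarrow> (\<sigma>, \<tau>) \<in> ?C"
  proof
    assume "pi_down n ?C \<sigma> = pi_down n ?C \<tau>"
    then show "(\<sigma>, \<tau>) \<in> ?C"
      using pi_down_in_class[OF C p(1)] pi_down_in_class[OF C p(2)]
        weak_congruence_sym[OF C] weak_congruence_trans[OF C] by metis
  next
    assume "(\<sigma>, \<tau>) \<in> ?C"
    then have "?C `` {\<sigma>} = ?C `` {\<tau>}"
      using equiv_class_eq[of "perms n" ?C] C unfolding weak_congruence_def by blast
    then show "pi_down n ?C \<sigma> = pi_down n ?C \<tau>" unfolding pi_down_def by simp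
  qed
  finally show ?thesis using p unfolding arc_equivalence_def by auto
qed

lemma eta_down_diagram:
  assumes I: "arc_ideal n I" and s: "\<sigma> \<in> perms n"
  shows "noncrossing_arc_diagram n (eta_down n I \<sigma>)" "eta_down n I \<sigma> \<subseteq> I"
proof -
  let ?C = "arc_equivalence n I"
  have C: "weak_congruence n ?C" by (rule weak_congruence_arc_equivalence[OF I])
  note m = class_minimal_pi_down[OF C s]
  show "noncrossing_arc_diagram n (eta_down n I \<sigma>)"
    unfolding eta_down_def arc_congruence_eq[OF I]
    using m noncrossing_delta_down unfolding class_minimal_def by blast
  show "eta_down n I \<sigma> \<subseteq> I"
    unfolding eta_down_def arc_congruence_eq[OF I]
    using delta_down_class_minimal[OF C m] congruence_arcs_arc_equivalence[OF I] by blast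
qed

section \<open>Multilinear bookkeeping\<close>

text \<open>The support of the vector may be replaced by a larger finite set, so that two vectors can be
  summed over the same set.\<close>

lemma linear_extension_superset:
  assumes "finite A" "Poly_Mapping.keys v \<subseteq> A"
  shows "linear_extension f v = (\<Sum>a\<in>A. free_scale (Poly_Mapping.lookup v a) (f a))"
  unfolding linear_extension_def
  by (rule sum.mono_neutral_left) (use assms in \<open>auto simp: in_keys_iff\<close>)

lemma linear_extension_add: "linear_extension f (u + v) = linear_extension f u + linear_extension f v"
proof -
  let ?A = "Poly_Mapping.keys u \<union> Poly_Mapping.keys v"
  have "finite ?A" "Poly_Mapping.keys (u + v) \<subseteq> ?A" by (simp_all add: Poly_Mapping.keys_add)
  then show ?thesis
    by (simp add: linear_extension_superset[of ?A] lookup_add free_vs.scale_left_distrib sum.distrib)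
qed

lemma linear_extension_scale:
  "linear_extension f (free_scale c v) = free_scale c (linear_extension f v)"
proof -
  have "Poly_Mapping.keys (free_scale c v) \<subseteq> Poly_Mapping.keys v"
    by (auto simp: in_keys_iff lookup_free_scale)
  then show ?thesis
    by (simp add: linear_extension_superset[of "Poly_Mapping.keys v"] lookup_free_scale
        free_vs.scale_sum_right)
qed

lemma linear_extension_zero: "linear_extension f 0 = 0"
  by (simp add: linear_extension_def)

lemma linear_extension_sum:
  "linear_extension f (\<Sum>i\<in>A. v i) = (\<Sum>i\<in>A. linear_extension f (v i))"
  by (induction A rule: infinite_finite_induct)
    (simp_all add: linear_extension_zero linear_extension_add)

lemma linear_extension_basis: "linear_extension f (basis_vec a) = f a"
  by (simp add: linear_extension_def basis_vec_def)

lemma linear_extension_in_subspace: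
  assumes "free_vs.subspace W" "\<And>u. u \<in> U \<Longrightarrow> linear_extension f u \<in> W" "u \<in> free_vs.span U"
  shows "linear_extension f u \<in> W"
  using assms(3)
  by (induction rule: free_vs.span_induct_alt)
    (use assms(1,2) in \<open>auto simp: linear_extension_zero linear_extension_add linear_extension_scale
      free_vs.subspace_0 free_vs.subspace_add free_vs.subspace_scale\<close>)

lemma bilinear_extension_in_subspace:
  assumes W: "free_vs.subspace W"
    and UV: "\<And>u v. u \<in> U \<Longrightarrow> v \<in> V \<Longrightarrow> bilinear_extension f u v \<in> W"
    and u: "u \<in> free_vs.span U" and v: "v \<in> free_vs.span V"
  shows "bilinear_extension f u v \<in> W"
proof -
  have right: "bilinear_extension f u v \<in> W" if "u \<in> U" for u
    using v
  proof (induction rule: free_vs.span_induct_alt)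
    case base
    then show ?case
      using free_vs.subspace_0[OF W]
      by (simp add: bilinear_extension_def linear_extension_zero linear_extension_def)
  next
    case (step c x y)
    have "bilinear_extension f u (free_scale c x + y) =
      free_scale c (bilinear_extension f u x) + bilinear_extension f u y"
      unfolding bilinear_extension_def linear_extension_add linear_extension_scale
      unfolding linear_extension_def[where v = u]
      by (simp add: free_vs.scale_right_distrib sum.distrib free_vs.scale_sum_right mult.commute)
    then show ?case
      using UV[OF that step(1)] step(2) W by (simp add: free_vs.subspace_add free_vs.subspace_scale)
  qed
  show ?thesis
    using right linear_extension_in_subspace[OF W _ u] unfolding bilinear_extension_def by blast
qed

lemma bilinear_extension_basis_sums:
  "bilinear_extension f (\<Sum>i\<in>A. basis_vec (g i)) (\<Sum>j\<in>B. basis_vec (h j)) =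
    (\<Sum>i\<in>A. \<Sum>j\<in>B. f (g i) (h j))"
  by (simp add: bilinear_extension_def linear_extension_sum linear_extension_basis)

lemma tensor_basis: "tensor (basis_vec a) (basis_vec b) = basis_vec (a, b)"
  by (simp add: tensor_def bilinear_extension_def linear_extension_basis)

lemma subspace_tensor_space: "free_vs.subspace (tensor_space U V)"
  unfolding tensor_space_def by (rule free_vs.subspace_span)

lemma tensor_in_tensor_space: "u \<in> U \<Longrightarrow> v \<in> V \<Longrightarrow> tensor u v \<in> tensor_space U V"
  unfolding tensor_space_def by (rule free_vs.span_base) blast

lemma subspace_kD: "free_vs.subspace (kD X Psi)"
  unfolding kD_def by (rule free_vs.subspace_span)

lemma P_elem_in_kD: "Dx \<in> decorated_diagrams X Psi n \<Longrightarrow> P_elem Psi n Dx \<in> kD X Psi"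
  unfolding kD_def by (rule free_vs.span_base) blast

lemma P_elem_in_kP_degree:
  assumes "Dx \<in> decorated_diagrams X Psi n"
  shows "P_elem Psi n Dx \<in> kP_degree X n"
proof -
  obtain D x where "Dx = (D, x)" "x \<in> X n"
    using assms unfolding decorated_diagrams_def by auto
  then show ?thesis
    unfolding P_elem_def kP_degree_def
    by (simp, intro free_vs.span_sum free_vs.span_base) auto
qed

lemma kP_degree_subset_kP: "kP_degree X n \<subseteq> kP X"
  unfolding kP_degree_def kP_def by (rule free_vs.span_mono) blast

lemma kD_subset_kP:
  fixes X :: "nat \<Rightarrow> 'x set"
  shows "kD X Psi \<subseteq> (kP X :: ('x decperm \<Rightarrow>\<^sub>0 'k::field) set)"
  unfolding kD_def
proof (rule free_vs.span_minimal)
  show "free_vs.subspace (kP X :: ('x decperm \<Rightarrow>\<^sub>0 'k::field) set)"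
    unfolding kP_def by (rule free_vs.subspace_span)
  show "(\<Union>n. P_elem Psi n ` decorated_diagrams X Psi n) \<subseteq> (kP X :: ('x decperm \<Rightarrow>\<^sub>0 'k) set)"
    by (intro UN_least image_subsetI) (rule subsetD[OF kP_degree_subset_kP P_elem_in_kP_degree])
qed

lemma graded_subspace_kD: "graded_subspace (kP_degree X) (kD X Psi)"
  unfolding graded_subspace_def
proof (intro conjI subspace_kD equalityI)
  let ?H = "\<Union>n. kD X Psi \<inter> kP_degree X n"
  have "(\<Union>n. P_elem Psi n ` decorated_diagrams X Psi n) \<subseteq> ?H"
    by (intro UN_mono image_subsetI IntI P_elem_in_kD P_elem_in_kP_degree subset_refl)
  from free_vs.span_mono[OF this] show "kD X Psi \<subseteq> free_vs.span ?H"
    unfolding kD_def .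
  show "free_vs.span ?H \<subseteq> kD X Psi"
    by (rule free_vs.span_minimal[OF _ subspace_kD]) blast
qed

context conservative_function
begin

lemma eta_fibre_in_diagrams:
  assumes "x \<in> X n" "\<sigma> \<in> perms n"
  shows "(eta_down n (Psi x) \<sigma>, x) \<in> decorated_diagrams X Psi n"
  using eta_down_diagram[OF Psi_ideal[OF assms(1)] assms(2)] assms(1)
  by (simp add: decorated_diagrams_def)

text \<open>Saturation means closure under the relation whose classes are the fibres of \<open>eta_down\<close>, so the sum
  splits into one \<open>P_elem\<close> for every fibre that it meets.\<close>

lemma saturated_sum_in_kD:
  assumes x: "x \<in> X n" and M: "M \<subseteq> perms n"
    and sat: "\<And>\<sigma> \<tau>. \<sigma> \<in> M \<Longrightarrow> \<tau> \<in> perms n \<Longrightarrow>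
      arcs_below (Psi x) \<sigma> = arcs_below (Psi x) \<tau> \<Longrightarrow> \<tau> \<in> M"
  shows "(\<Sum>\<sigma>\<in>M. basis_vec (\<sigma>, x)) \<in> (kD X Psi :: ('x decperm \<Rightarrow>\<^sub>0 'k::field) set)"
proof -
  let ?\<eta> = "eta_down n (Psi x)"
  have fin: "finite M" by (rule finite_subset[OF M]) simp
  have fibre: "{\<sigma> \<in> M. ?\<eta> \<sigma> = ?\<eta> \<tau>} = {\<sigma> \<in> perms n. ?\<eta> \<sigma> = ?\<eta> \<tau>}" if "\<tau> \<in> M" for \<tau>
  proof (intro equalityI subsetI CollectI conjI; elim CollectE conjE)
    fix \<sigma> assume \<sigma>: "\<sigma> \<in> perms n" "?\<eta> \<sigma> = ?\<eta> \<tau>"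
    have "\<tau> \<in> perms n" using that M by auto
    then have "arcs_below (Psi x) \<tau> = arcs_below (Psi x) \<sigma>"
      using eta_down_eq_iff[OF Psi_ideal[OF x] _ \<sigma>(1), of \<tau>] \<sigma>(2) by simp
    then show "\<sigma> \<in> M" by (rule sat[OF that \<sigma>(1)])
  qed (use M in auto)
  have "(\<Sum>\<sigma>\<in>M. basis_vec (\<sigma>, x) :: 'x decperm \<Rightarrow>\<^sub>0 'k) =
    (\<Sum>D\<in>?\<eta> ` M. \<Sum>\<sigma> | \<sigma> \<in> M \<and> ?\<eta> \<sigma> = D. basis_vec (\<sigma>, x))"
    by (rule sum.image_gen[OF fin])
  also have "\<dots> = (\<Sum>D\<in>?\<eta> ` M. P_elem Psi n (D, x))"
    by (rule sum.cong[OF refl]) (auto simp: P_elem_def fibre)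
  also have "\<dots> \<in> kD X Psi"
    using M eta_fibre_in_diagrams[OF x]
    by (intro free_vs.subspace_sum[OF subspace_kD] P_elem_in_kD) auto
  finally show ?thesis .
qed

lemma saturated_sum_in_tensor_space:
  assumes x: "x \<in> X m" and y: "y \<in> X n" and M: "M \<subseteq> perms m \<times> perms n"
    and sat: "\<And>\<sigma> \<tau> \<sigma>' \<tau>'. (\<sigma>, \<tau>) \<in> M \<Longrightarrow> \<sigma>' \<in> perms m \<Longrightarrow> \<tau>' \<in> perms n \<Longrightarrow>
      arcs_below (Psi x) \<sigma> = arcs_below (Psi x) \<sigma>' \<Longrightarrow>
      arcs_below (Psi y) \<tau> = arcs_below (Psi y) \<tau>' \<Longrightarrow> (\<sigma>', \<tau>') \<in> M"
  shows "(\<Sum>(\<sigma>, \<tau>)\<in>M. basis_vec ((\<sigma>, x), (\<tau>, y))) \<in>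
    tensor_space (kD X Psi) (kD X Psi :: ('x decperm \<Rightarrow>\<^sub>0 'k::field) set)"
proof -
  let ?h = "\<lambda>(\<sigma>, \<tau>). (eta_down m (Psi x) \<sigma>, eta_down n (Psi y) \<tau>)"
  let ?A = "\<lambda>D. {\<sigma>. \<sigma> \<in> perms m \<and> eta_down m (Psi x) \<sigma> = D}"
  let ?B = "\<lambda>E. {\<tau>. \<tau> \<in> perms n \<and> eta_down n (Psi y) \<tau> = E}"
  let ?f = "\<lambda>(\<sigma>, \<tau>). basis_vec ((\<sigma>, x), (\<tau>, y)) :: 'x decperm \<times> 'x decperm \<Rightarrow>\<^sub>0 'k"
  have fin: "finite M" by (rule finite_subset[OF M]) simp
  have fibre: "{p \<in> M. ?h p = (D, E)} = ?A D \<times> ?B E" if DE: "(D, E) \<in> ?h ` M" for D E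
  proof -
    obtain \<sigma> \<tau> where st: "(\<sigma>, \<tau>) \<in> M" "D = eta_down m (Psi x) \<sigma>" "E = eta_down n (Psi y) \<tau>"
      using DE by auto
    then have p: "\<sigma> \<in> perms m" "\<tau> \<in> perms n" using M by auto
    have "(\<sigma>', \<tau>') \<in> M" if "\<sigma>' \<in> ?A D" "\<tau>' \<in> ?B E" for \<sigma>' \<tau>'
      using that sat[OF st(1), of \<sigma>' \<tau>'] st(2,3)
        eta_down_eq_iff[OF Psi_ideal[OF x] p(1), of \<sigma>'] eta_down_eq_iff[OF Psi_ideal[OF y] p(2), of \<tau>']
      by simp
    then show ?thesis using M by auto
  qed
  have "(\<Sum>p\<in>M. ?f p) = (\<Sum>DE\<in>?h ` M. \<Sum>p | p \<in> M \<and> ?h p = DE. ?f p)"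
    by (rule sum.image_gen[OF fin])
  also have "\<dots> = (\<Sum>(D, E)\<in>?h ` M. tensor (P_elem Psi m (D, x)) (P_elem Psi n (E, y)))"
  proof (rule sum.cong[OF refl])
    fix DE assume "DE \<in> ?h ` M"
    then obtain D E where DE: "DE = (D, E)" "(D, E) \<in> ?h ` M" by (cases DE) auto
    have "tensor (P_elem Psi m (D, x)) (P_elem Psi n (E, y)) = (\<Sum>p\<in>?A D \<times> ?B E. ?f p)"
      by (simp add: P_elem_def tensor_def bilinear_extension_basis_sums sum.cartesian_product)
    then show "(\<Sum>p | p \<in> M \<and> ?h p = DE. ?f p) =
      (case DE of (D, E) \<Rightarrow> tensor (P_elem Psi m (D, x)) (P_elem Psi n (E, y)))"
      using fibre[OF DE(2)] by (simp add: DE(1))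
  qed
  also have "\<dots> \<in> tensor_space (kD X Psi) (kD X Psi)"
  proof (rule free_vs.subspace_sum[OF subspace_tensor_space])
    fix DE assume "DE \<in> ?h ` M"
    then obtain \<sigma> \<tau> where "(\<sigma>, \<tau>) \<in> M" "DE = ?h (\<sigma>, \<tau>)" by auto
    then show "(case DE of (D, E) \<Rightarrow> tensor (P_elem Psi m (D, x)) (P_elem Psi n (E, y))) \<in>
        tensor_space (kD X Psi) (kD X Psi)"
      using M by (auto intro!: tensor_in_tensor_space P_elem_in_kD
          eta_fibre_in_diagrams[OF x] eta_fibre_in_diagrams[OF y])
  qed
  finally show ?thesis .
qed

end

section \<open>Products\<close>

text \<open>The inverse of \<open>nth_elem R\<close> on \<open>R\<close>; standardization of a word replaces each letter by its rank.\<close>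

definition rank :: "nat set \<Rightarrow> nat \<Rightarrow> nat" where
  "rank R x = card {y \<in> R. y \<le> x}"

lemma nth_elem_mono:
  assumes "finite R" "1 \<le> i" "i < j" "j \<le> card R"
  shows "nth_elem R i < nth_elem R j"
  unfolding nth_elem_def
  using assms sorted_wrt_nth_less[of "(<)" "sorted_list_of_set R" "i - 1" "j - 1"] by simp

lemma nth_elem_in:
  assumes "finite R" "1 \<le> i" "i \<le> card R"
  shows "nth_elem R i \<in> R"
proof -
  have "nth_elem R i \<in> set (sorted_list_of_set R)"
    unfolding nth_elem_def by (rule nth_mem) (use assms in simp)
  then show ?thesis using assms(1) by simp
qed

lemma nth_elem_surj:
  assumes "finite R" "x \<in> R"
  obtains i where "1 \<le> i" "i \<le> card R" "nth_elem R i = x"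
proof -
  have "x \<in> set (sorted_list_of_set R)" using assms by simp
  then obtain k where "k < length (sorted_list_of_set R)" "sorted_list_of_set R ! k = x"
    unfolding in_set_conv_nth by blast
  then show ?thesis using that[of "Suc k"] by (simp add: nth_elem_def)
qed

lemma nth_elem_le_iff:
  assumes "finite R" "1 \<le> i" "i \<le> card R" "1 \<le> j" "j \<le> card R"
  shows "nth_elem R i \<le> nth_elem R j \<longleftrightarrow> i \<le> j"
  using nth_elem_mono[OF assms(1), of i j] nth_elem_mono[OF assms(1), of j i] assms
  by (cases i j rule: linorder_cases) auto

lemma rank_nth_elem:
  assumes R: "finite R" and i: "1 \<le> i" "i \<le> card R"
  shows "rank R (nth_elem R i) = i"
proof -
  have "{y \<in> R. y \<le> nth_elem R i} = nth_elem R ` {1..i}"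
  proof (intro equalityI subsetI)
    fix y assume "y \<in> {y \<in> R. y \<le> nth_elem R i}"
    then have y: "y \<in> R" "y \<le> nth_elem R i" by auto
    obtain j where j: "1 \<le> j" "j \<le> card R" "nth_elem R j = y" using nth_elem_surj[OF R y(1)] .
    then have "j \<le> i" using nth_elem_le_iff[OF R j(1,2) i] y by simp
    then show "y \<in> nth_elem R ` {1..i}" using j by auto
  next
    fix y assume "y \<in> nth_elem R ` {1..i}"
    then obtain j where j: "1 \<le> j" "j \<le> i" "y = nth_elem R j" by auto
    then show "y \<in> {y \<in> R. y \<le> nth_elem R i}"
      using nth_elem_in[OF R, of j] nth_elem_le_iff[OF R, of j i] i by auto
  qed
  moreover have "inj_on (nth_elem R) {1..i}"
  proof (rule inj_onI)
    fix j k assume "j \<in> {1..i}" "k \<in> {1..i}" "nth_elem R j = nth_elem R k"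
    then show "j = k"
      using nth_elem_le_iff[OF R, of j k] nth_elem_le_iff[OF R, of k j] i by auto
  qed
  ultimately show ?thesis unfolding rank_def by (simp add: card_image)
qed

lemma rank_bounds:
  assumes "finite R" "x \<in> R"
  shows "1 \<le> rank R x" "rank R x \<le> card R"
  using nth_elem_surj[OF assms] rank_nth_elem[OF assms(1)] by metis+

lemma nth_elem_rank:
  assumes "finite R" "x \<in> R"
  shows "nth_elem R (rank R x) = x"
  using nth_elem_surj[OF assms] rank_nth_elem[OF assms(1)] by metis

lemma nth_elem_inj: "finite R \<Longrightarrow> inj_on (nth_elem R) {1..card R}"
  by (rule inj_on_inverseI[of _ "rank R"]) (simp add: rank_nth_elem)

lemma nth_elem_image:
  assumes "finite R"
  shows "nth_elem R ` {1..card R} = R"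
proof (intro equalityI subsetI)
  fix x assume "x \<in> R"
  then show "x \<in> nth_elem R ` {1..card R}"
    using nth_elem_surj[OF assms] by (metis atLeastAtMost_iff imageI)
qed (use nth_elem_in[OF assms] in auto)

lemma std_word_eq: "std_word w = map (rank (set w)) w"
  unfolding std_word_def rank_def ..

lemma map_nth_elem_std_word: "map (nth_elem (set w)) (std_word w) = w"
  by (simp add: std_word_eq map_idI nth_elem_rank)

lemma std_word_perms:
  assumes "distinct w"
  shows "std_word w \<in> perms (length w)"
proof (rule permsI)
  have "inj_on (rank (set w)) (set w)"
    by (rule inj_on_inverseI[of _ "nth_elem (set w)"]) (simp add: nth_elem_rank)
  then show "distinct (std_word w)"
    using assms by (simp add: std_word_eq distinct_map)
  have "rank (set w) ` nth_elem (set w) ` {1..card (set w)} = {1..card (set w)}"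
    unfolding image_image by (force simp: rank_nth_elem)
  then show "set (std_word w) = {1..length w}"
    unfolding nth_elem_image[OF finite_set] using distinct_card[OF assms] by (simp add: std_word_eq)
qed

lemma std_word_map_nth_elem:
  assumes "finite R" "\<sigma> \<in> perms (card R)"
  shows "std_word (map (nth_elem R) \<sigma>) = \<sigma>" "distinct (map (nth_elem R) \<sigma>)"
    "set (map (nth_elem R) \<sigma>) = R"
proof -
  have s: "set \<sigma> = {1..card R}" "distinct \<sigma>" using permsD[OF assms(2)] by auto
  show set_eq: "set (map (nth_elem R) \<sigma>) = R" using s nth_elem_image[OF assms(1)] by simp
  show "distinct (map (nth_elem R) \<sigma>)" using s nth_elem_inj[OF assms(1)] by (simp add: distinct_map)
  show "std_word (map (nth_elem R) \<sigma>) = \<sigma>"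
    unfolding std_word_eq set_eq map_map
    by (rule map_idI) (use s in \<open>simp add: rank_nth_elem[OF assms(1)]\<close>)
qed

lemma inversions_std_word:
  assumes d: "distinct w"
  shows "(j, i) \<in> inversions (std_word w) \<longleftrightarrow> 1 \<le> i \<and> i < j \<and> j \<le> length w \<and>
    before w (nth_elem (set w) j) (nth_elem (set w) i)"
proof -
  have s: "std_word w \<in> perms (length w)" by (rule std_word_perms[OF d])
  have "before (std_word w) j i \<longleftrightarrow> before w (nth_elem (set w) j) (nth_elem (set w) i)"
    if "1 \<le> i" "i < j" "j \<le> length w"
    using before_map[of "nth_elem (set w)" "std_word w" j i] that permsD[OF s]
      nth_elem_inj[of "set w"] distinct_card[OF d] by (simp add: map_nth_elem_std_word)
  moreover have "1 \<le> i \<and> j \<le> length w" if "before (std_word w) j i"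
    using before_in_set[OF that] permsD[OF s] by simp
  ultimately show ?thesis unfolding inversions_eq_before by auto
qed

lemma nth_elem_interval:
  assumes "1 \<le> i" "i \<le> n"
  shows "nth_elem {m + 1..m + n} i = i + m"
proof -
  have "{y \<in> {m + 1..m + n}. y \<le> i + m} = {m + 1..i + m}" using assms by auto
  then have "rank {m + 1..m + n} (i + m) = i" unfolding rank_def by simp
  then show ?thesis using nth_elem_rank[of "{m + 1..m + n}" "i + m"] assms by simp
qed

text \<open>Covers both restrictions in a shifted shuffle: \<open>m = 0\<close> gives the small values.\<close>

lemma stdv_interval:
  assumes r: "\<rho> \<in> perms p" and mn: "m + n \<le> p"
  shows "stdv \<rho> {m + 1..m + n} \<in> perms n"
    and "(j, i) \<in> inversions (stdv \<rho> {m + 1..m + n}) \<longleftrightarrow>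
      1 \<le> i \<and> j \<le> n \<and> (j + m, i + m) \<in> inversions \<rho>"
proof -
  let ?w = "filter (\<lambda>v. v \<in> {m + 1..m + n}) \<rho>"
  have d: "distinct ?w" and s: "set ?w = {m + 1..m + n}" using permsD[OF r] mn by auto
  have l: "length ?w = n" using distinct_card[OF d] unfolding s by simp
  show "stdv \<rho> {m + 1..m + n} \<in> perms n"
    unfolding stdv_def using std_word_perms[OF d] l by simp
  show "(j, i) \<in> inversions (stdv \<rho> {m + 1..m + n}) \<longleftrightarrow>
      1 \<le> i \<and> j \<le> n \<and> (j + m, i + m) \<in> inversions \<rho>"
    unfolding stdv_def inversions_std_word[OF d] l s
  proof (cases "1 \<le> i \<and> i < j \<and> j \<le> n")
    case True
    then show "1 \<le> i \<and> i < j \<and> j \<le> n \<and>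
        before ?w (nth_elem {m + 1..m + n} j) (nth_elem {m + 1..m + n} i) \<longleftrightarrow>
      1 \<le> i \<and> j \<le> n \<and> (j + m, i + m) \<in> inversions \<rho>"
      using nth_elem_interval[of i n m] nth_elem_interval[of j n m]
      by (simp add: before_filter inversions_eq_before)
  qed (auto simp: inversions_eq_before)
qed

lemma arc_inversions_extend: "arc_inversions (arc_extend n \<alpha>) = arc_inversions \<alpha>"
  by (cases \<alpha>) simp

lemma arc_inversions_shift:
  "arc_inversions (arc_shift m \<alpha>) = (\<lambda>(y, x). (y + m, x + m)) ` arc_inversions \<alpha>"
proof -
  obtain a b k S where \<alpha>: "\<alpha> = (a, b, k, S)" by (cases \<alpha>)
  show ?thesis
  proof (intro equalityI subrelI)
    fix y x assume yx: "(y, x) \<in> arc_inversions (arc_shift m \<alpha>)"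
    then have "m \<le> x" "m \<le> y" unfolding \<alpha> by auto
    then obtain x' y' where "x = x' + m" "y = y' + m" by (metis le_add_diff_inverse2)
    then show "(y, x) \<in> (\<lambda>(y, x). (y + m, x + m)) ` arc_inversions \<alpha>"
      using yx unfolding \<alpha> by (intro image_eqI[of _ _ "(y', x')"]) auto
  qed (auto simp: \<alpha>)
qed

context conservative_function
begin

text \<open>An arc of \<open>Psi x\<close> lies below the restriction of \<open>\<rho>\<close> to small values iff its extension lies below
  \<open>\<rho>\<close>, and an arc of \<open>Psi y\<close> lies below the restriction to large values iff its shift lies below \<open>\<rho>\<close>.
  The extension and the shift belong to \<open>Psi (conc x y)\<close>.\<close>

lemma shifted_shuffle_classes:
  assumes x: "x \<in> X m" and y: "y \<in> X n" and r: "\<rho> \<in> perms (m + n)" "\<rho>' \<in> perms (m + n)"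
    and eq: "arcs_below (Psi (conc x y)) \<rho> = arcs_below (Psi (conc x y)) \<rho>'"
  shows "arcs_below (Psi x) (stdv \<rho> {1..m}) = arcs_below (Psi x) (stdv \<rho>' {1..m})"
    and "arcs_below (Psi y) (stdv \<rho> {m + 1..m + n}) = arcs_below (Psi y) (stdv \<rho>' {m + 1..m + n})"
proof -
  have iff: "arc_inversions \<gamma> \<subseteq> inversions \<rho> \<longleftrightarrow> arc_inversions \<gamma> \<subseteq> inversions \<rho>'"
    if "\<gamma> \<in> Psi (conc x y)" for \<gamma>
    using eq that unfolding arcs_below_def by blast
  have low: "arc_inversions \<alpha> \<subseteq> inversions (stdv \<pi> {1..m}) \<longleftrightarrow>
      arc_inversions (arc_extend n \<alpha>) \<subseteq> inversions \<pi>"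
    if \<alpha>: "\<alpha> \<in> Psi x" and p: "\<pi> \<in> perms (m + n)" for \<alpha> \<pi>
  proof -
    have "\<alpha> \<in> arcs m" using \<alpha> Psi_ideal[OF x] unfolding arc_ideal_def by blast
    then have b: "1 \<le> i \<and> j \<le> m" if "(j, i) \<in> arc_inversions \<alpha>" for i j
      using biclosed_bounds[OF biclosed_arc_inversions that] by blast
    show ?thesis
      unfolding arc_inversions_extend
      using stdv_interval(2)[OF p, of 0 m] b by auto
  qed
  have high: "arc_inversions \<alpha> \<subseteq> inversions (stdv \<pi> {m + 1..m + n}) \<longleftrightarrow>
      arc_inversions (arc_shift m \<alpha>) \<subseteq> inversions \<pi>"
    if \<alpha>: "\<alpha> \<in> Psi y" and p: "\<pi> \<in> perms (m + n)" for \<alpha> \<pi>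
  proof -
    have "\<alpha> \<in> arcs n" using \<alpha> Psi_ideal[OF y] unfolding arc_ideal_def by blast
    then have b: "1 \<le> i \<and> j \<le> n" if "(j, i) \<in> arc_inversions \<alpha>" for i j
      using biclosed_bounds[OF biclosed_arc_inversions that] by blast
    show ?thesis
      unfolding arc_inversions_shift
      using stdv_interval(2)[OF p, of m n] b by auto
  qed
  have "arc_inversions \<alpha> \<subseteq> inversions (stdv \<rho> {1..m}) \<longleftrightarrow>
      arc_inversions \<alpha> \<subseteq> inversions (stdv \<rho>' {1..m})" if "\<alpha> \<in> Psi x" for \<alpha>
  proof -
    have "arc_extend n \<alpha> \<in> Psi (conc x y)" using Psi_conc_left[OF x y] that by blast
    then show ?thesis using low[OF that r(1)] low[OF that r(2)] iff by simp
  qed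
  then show "arcs_below (Psi x) (stdv \<rho> {1..m}) = arcs_below (Psi x) (stdv \<rho>' {1..m})"
    unfolding arcs_below_def by (rule Collect_cong[OF conj_cong[OF refl]])
  have "arc_inversions \<alpha> \<subseteq> inversions (stdv \<rho> {m + 1..m + n}) \<longleftrightarrow>
      arc_inversions \<alpha> \<subseteq> inversions (stdv \<rho>' {m + 1..m + n})" if "\<alpha> \<in> Psi y" for \<alpha>
  proof -
    have "arc_shift m \<alpha> \<in> Psi (conc x y)" using Psi_conc_right[OF x y] that by blast
    then show ?thesis using high[OF that r(1)] high[OF that r(2)] iff by simp
  qed
  then show "arcs_below (Psi y) (stdv \<rho> {m + 1..m + n}) = arcs_below (Psi y) (stdv \<rho>' {m + 1..m + n})"
    unfolding arcs_below_def by (rule Collect_cong[OF conj_cong[OF refl]])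
qed

text \<open>Each \<open>\<rho>\<close> lies in exactly one shifted shuffle, so the product is the sum over all \<open>\<rho>\<close> whose two
  restrictions lie in the prescribed fibres. This set of permutations is saturated.\<close>

lemma P_elem_mult_in_kD:
  assumes "Dx \<in> decorated_diagrams X Psi m" "Ey \<in> decorated_diagrams X Psi n"
  shows "kP_mult conc (P_elem Psi m Dx) (P_elem Psi n Ey) \<in> (kD X Psi :: ('x decperm \<Rightarrow>\<^sub>0 'k::field) set)"
proof -
  obtain D x where Dx: "Dx = (D, x)" and x: "x \<in> X m"
    using assms(1) unfolding decorated_diagrams_def by auto
  obtain E y where Ey: "Ey = (E, y)" and y: "y \<in> X n"
    using assms(2) unfolding decorated_diagrams_def by auto
  let ?A = "{\<sigma>. \<sigma> \<in> perms m \<and> eta_down m (Psi x) \<sigma> = D}"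
  let ?B = "{\<tau>. \<tau> \<in> perms n \<and> eta_down n (Psi y) \<tau> = E}"
  let ?l = "\<lambda>\<rho>. stdv \<rho> {1..m}" and ?h = "\<lambda>\<rho>. stdv \<rho> {m + 1..m + n}"
  let ?M = "{\<rho> \<in> perms (m + n). ?l \<rho> \<in> ?A \<and> ?h \<rho> \<in> ?B}"
  let ?f = "\<lambda>\<rho>. basis_vec (\<rho>, conc x y) :: 'x decperm \<Rightarrow>\<^sub>0 'k"
  have xy: "conc x y \<in> X (m + n)" by (rule conc_closed[OF x y])
  have fibre: "shifted_shuffle \<sigma> \<tau> = {\<rho> \<in> ?M. (?l \<rho>, ?h \<rho>) = (\<sigma>, \<tau>)}"
    if st: "\<sigma> \<in> ?A" "\<tau> \<in> ?B" for \<sigma> \<tau>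
  proof -
    have "length \<sigma> = m" "length \<tau> = n" using st permsD by blast+
    moreover have "{1..m + n} - {1..m} = {m + 1..m + n}" by auto
    ultimately show ?thesis unfolding shifted_shuffle_def Let_def using st by auto
  qed
  have "kP_mult conc (P_elem Psi m Dx) (P_elem Psi n Ey) =
      (\<Sum>\<sigma>\<in>?A. \<Sum>\<tau>\<in>?B. \<Sum>\<rho>\<in>shifted_shuffle \<sigma> \<tau>. ?f \<rho>)"
    unfolding kP_mult_def Dx Ey P_elem_def by (simp add: bilinear_extension_basis_sums)
  also have "\<dots> = (\<Sum>(\<sigma>, \<tau>)\<in>?A \<times> ?B. \<Sum>\<rho>\<in>shifted_shuffle \<sigma> \<tau>. ?f \<rho>)"
    by (rule sum.cartesian_product)
  also have "\<dots> = (\<Sum>p\<in>?A \<times> ?B. \<Sum>\<rho> | \<rho> \<in> ?M \<and> (?l \<rho>, ?h \<rho>) = p. ?f \<rho>)"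
  proof (rule sum.cong[OF refl])
    fix p assume "p \<in> ?A \<times> ?B"
    then obtain \<sigma> \<tau> where p: "p = (\<sigma>, \<tau>)" "\<sigma> \<in> ?A" "\<tau> \<in> ?B" by blast
    show "(case p of (\<sigma>, \<tau>) \<Rightarrow> \<Sum>\<rho>\<in>shifted_shuffle \<sigma> \<tau>. ?f \<rho>) =
        (\<Sum>\<rho> | \<rho> \<in> ?M \<and> (?l \<rho>, ?h \<rho>) = p. ?f \<rho>)"
      unfolding p(1) prod.case fibre[OF p(2,3)] ..
  qed
  also have "\<dots> = (\<Sum>\<rho>\<in>?M. ?f \<rho>)"
    by (rule sum.group) auto
  also have "\<dots> \<in> kD X Psi"
  proof (rule saturated_sum_in_kD[OF xy])
    fix \<rho> \<rho>' assume a: "\<rho> \<in> ?M" "\<rho>' \<in> perms (m + n)"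
      "arcs_below (Psi (conc x y)) \<rho> = arcs_below (Psi (conc x y)) \<rho>'"
    then have r: "\<rho> \<in> perms (m + n)" "?l \<rho> \<in> ?A" "?h \<rho> \<in> ?B" by auto
    have p: "?l \<rho>' \<in> perms m" "?h \<rho>' \<in> perms n"
      using stdv_interval(1)[OF a(2), of 0 m] stdv_interval(1)[OF a(2), of m n] by simp_all
    note classes = shifted_shuffle_classes[OF x y r(1) a(2,3)]
    have "eta_down m (Psi x) (?l \<rho>') = D"
      using eta_down_eq_iff[OF Psi_ideal[OF x] _ p(1), of "?l \<rho>"] classes(1) r(2) by simp
    moreover have "eta_down n (Psi y) (?h \<rho>') = E"
      using eta_down_eq_iff[OF Psi_ideal[OF y] _ p(2), of "?h \<rho>"] classes(2) r(3) by simp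
    ultimately show "\<rho>' \<in> ?M" using a(2) p by blast
  qed blast
  finally show ?thesis .
qed

end

section \<open>Coproducts\<close>

lemma stdp_prefix: "stdp \<rho> {1..k} = std_word (take k \<rho>)"
proof -
  have "{i. Suc i \<in> {1..k}} = {..<k}" by auto
  then show "stdp \<rho> {1..k} = std_word (take k \<rho>)" unfolding stdp_def by (simp only: nths_upt_eq_take)
qed

lemma stdp_suffix: "stdp \<rho> ({1..length \<rho>} - {1..k}) = std_word (drop k \<rho>)"
proof -
  have "nths \<rho> {i. Suc i \<in> {1..length \<rho>} - {1..k}} = nths \<rho> {i. k \<le> i}"
    unfolding nths_def by (rule arg_cong[where f = "map fst"]) (auto intro!: filter_cong simp: set_zip)
  then show ?thesis unfolding stdp_def by (simp add: drop_eq_nths)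
qed

lemma entry_image: "entry \<rho> ` {1..k} = (!) \<rho> ` {..<k}"
  unfolding entry_def by (force simp: image_iff)

lemma entry_image_prefix: "k \<le> length \<rho> \<Longrightarrow> entry \<rho> ` {1..k} = set (take k \<rho>)"
  unfolding entry_image by (simp add: nth_image flip: atLeast0LessThan)

lemma entry_image_suffix:
  assumes "distinct \<rho>" "k \<le> length \<rho>"
  shows "entry \<rho> ` ({1..length \<rho>} - {1..k}) = set \<rho> - set (take k \<rho>)"
proof -
  have "inj_on (entry \<rho>) {1..length \<rho>}"
    unfolding entry_def using assms(1) by (auto intro!: inj_onI simp: nth_eq_iff_index_eq)
  then have "entry \<rho> ` ({1..length \<rho>} - {1..k}) = entry \<rho> ` {1..length \<rho>} - entry \<rho> ` {1..k}"
    using assms(2) by (intro inj_on_image_set_diff[of _ "{1..length \<rho>}"]) auto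
  then show ?thesis using assms(2) by (simp only: entry_image_prefix) (simp add: entry_image_prefix)
qed

context conservative_function
begin

text \<open>The arc from \<open>x\<close> to \<open>y\<close> restricts to an arc of \<open>Psi (sel z R)\<close> between their ranks. The restricted arc
  lies below the standardization of \<open>w\<close>, hence below that of \<open>w'\<close>, and so it inverts \<open>y\<close> and \<open>x\<close> there.\<close>

lemma before_subword_transfer:
  assumes z: "z \<in> X p" and R: "R \<subseteq> {1..p}"
    and w: "distinct w" "set w = R" and w': "distinct w'" "set w' = R"
    and eq: "arcs_below (Psi (sel z R)) (std_word w) = arcs_below (Psi (sel z R)) (std_word w')"
    and arc: "(x, y, p, T) \<in> Psi z" and xy: "x \<in> R" "y \<in> R"
    and inv: "\<And>v u. (v, u) \<in> arc_inversions (x, y, p, T) \<Longrightarrow> u \<in> R \<Longrightarrow> v \<in> R \<Longrightarrow> before w v u"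
  shows "before w' y x"
proof -
  have fin: "finite R" using R finite_subset by blast
  have "(x, y, p, T) \<in> arcs p" using arc Psi_ideal[OF z] unfolding arc_ideal_def by blast
  then have T: "x < y" "T \<subseteq> {x<..<y}" by (auto simp: arcs_iff)
  have l: "length w = card R" "length w' = card R" using w w' distinct_card by metis+
  let ?a = "rank R x" and ?b = "rank R y"
  let ?T = "{c \<in> {1..card R}. nth_elem R c \<in> T}"
  have a: "1 \<le> ?a" "?a \<le> card R" "nth_elem R ?a = x"
    using rank_bounds[OF fin xy(1)] nth_elem_rank[OF fin xy(1)] by auto
  have b: "1 \<le> ?b" "?b \<le> card R" "nth_elem R ?b = y"
    using rank_bounds[OF fin xy(2)] nth_elem_rank[OF fin xy(2)] by auto
  have ab: "?a < ?b" using nth_elem_le_iff[OF fin b(1,2) a(1,2)] a(3) b(3) T(1) by simp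
  let ?\<beta> = "(?a, ?b, card R, ?T)"
  have \<beta>: "?\<beta> \<in> Psi (sel z R)"
    using Psi_sel[OF z R a(1) ab b(2), of T] T(2) arc a(3) b(3) by simp
  have "arc_inversions ?\<beta> \<subseteq> inversions (std_word w)"
  proof (rule subrelI)
    fix j i assume ji: "(j, i) \<in> arc_inversions ?\<beta>"
    then have i: "?a \<le> i" "i < ?b" "i \<notin> ?T" and j: "j = ?b \<or> j \<in> ?T" and ij: "i < j" by auto
    have bounds: "1 \<le> i" "i \<le> card R" "1 \<le> j" "j \<le> card R" using i j a b by auto
    have "x \<le> nth_elem R i" using nth_elem_le_iff[OF fin a(1,2) bounds(1,2)] i(1) a(3) by simp
    moreover have "nth_elem R i < nth_elem R j"
      by (rule nth_elem_mono[OF fin bounds(1) ij bounds(4)])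
    moreover have "nth_elem R i < y" using nth_elem_mono[OF fin bounds(1) i(2) b(2)] b(3) by simp
    moreover have "nth_elem R i \<notin> T" using i(3) bounds by auto
    moreover have "nth_elem R j \<in> insert y T" using j b(3) by auto
    ultimately have "(nth_elem R j, nth_elem R i) \<in> arc_inversions (x, y, p, T)" by simp
    then have "before w (nth_elem R j) (nth_elem R i)"
      by (rule inv) (use nth_elem_in[OF fin] bounds in auto)
    then show "(j, i) \<in> inversions (std_word w)"
      unfolding inversions_std_word[OF w(1)] w(2) using bounds ij l by simp
  qed
  then have "?\<beta> \<in> arcs_below (Psi (sel z R)) (std_word w')"
    unfolding eq[symmetric] using \<beta> unfolding arcs_below_def by blast
  then have "arc_inversions ?\<beta> \<subseteq> inversions (std_word w')"
    unfolding arcs_below_def by blast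
  moreover have "(?b, ?a) \<in> arc_inversions ?\<beta>"
    using ab a(3) T(2) by auto
  ultimately have "(?b, ?a) \<in> inversions (std_word w')" by blast
  then show ?thesis
    unfolding inversions_std_word[OF w'(1)] w'(2) using a(3) b(3) by simp
qed

text \<open>Let \<open>(y, x)\<close> be an inversion of an arc of \<open>Psi z\<close> below \<open>u @ v\<close>. If \<open>x\<close> and \<open>y\<close> are letters of the same
  factor, the subarc from \<open>x\<close> to \<open>y\<close> is in the ideal \<open>Psi z\<close> and its inversions within that factor transfer
  to the new one. Otherwise \<open>y\<close> is in \<open>R\<close> and \<open>x\<close> is not, which inverts them in \<open>u' @ v'\<close> as well.\<close>

lemma arcs_below_append:
  assumes z: "z \<in> X p" and p: "u @ v \<in> perms p" "u' @ v' \<in> perms p"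
    and R: "set u = R" "set u' = R"
    and equ: "arcs_below (Psi (sel z R)) (std_word u) = arcs_below (Psi (sel z R)) (std_word u')"
    and eqv: "arcs_below (Psi (sel z ({1..p} - R))) (std_word v) =
      arcs_below (Psi (sel z ({1..p} - R))) (std_word v')"
  shows "arcs_below (Psi z) (u @ v) \<subseteq> arcs_below (Psi z) (u' @ v')"
proof
  let ?Q = "{1..p} - R"
  have d: "distinct u" "distinct v" "distinct u'" "distinct v'"
    and Q: "set v = ?Q" "set v' = ?Q" and Rp: "R \<subseteq> {1..p}"
    using permsD[OF p(1)] permsD[OF p(2)] R by auto
  fix \<alpha> assume "\<alpha> \<in> arcs_below (Psi z) (u @ v)"
  then have \<alpha>: "\<alpha> \<in> Psi z" and sub: "arc_inversions \<alpha> \<subseteq> inversions (u @ v)"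
    unfolding arcs_below_def by auto
  have \<alpha>a: "\<alpha> \<in> arcs p" using \<alpha> Psi_ideal[OF z] unfolding arc_ideal_def by blast
  then obtain a b S where \<alpha>_eq: "\<alpha> = (a, b, p, S)" unfolding arcs_def by blast
  have ab: "1 \<le> a" "a < b" "b \<le> p" "S \<subseteq> {a<..<b}" using \<alpha>a unfolding \<alpha>_eq by (auto simp: arcs_iff)
  have "arc_inversions \<alpha> \<subseteq> inversions (u' @ v')"
  proof (rule subrelI)
    fix y x assume yx: "(y, x) \<in> arc_inversions \<alpha>"
    then have xy: "a \<le> x" "x < y" "y \<le> b" unfolding \<alpha>_eq using ab by auto
    have arc: "(x, y, p, S \<inter> {x<..<y}) \<in> Psi z"
      using Psi_ideal[OF z] \<alpha> xy unfolding \<alpha>_eq arc_ideal_def by blast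
    have inv: "before (u @ v) t s" if "(t, s) \<in> arc_inversions (x, y, p, S \<inter> {x<..<y})" for t s
    proof -
      have "(t, s) \<in> arc_inversions \<alpha>" using that yx ab unfolding \<alpha>_eq by auto
      then show ?thesis using sub unfolding inversions_eq_before by blast
    qed
    have "before (u @ v) y x" using sub yx unfolding inversions_eq_before by blast
    then consider "x \<in> R" "y \<in> R" | "x \<in> ?Q" "y \<in> ?Q" | "y \<in> R" "x \<in> ?Q"
      unfolding before_append using before_in_set[of u y x] before_in_set[of v y x] R Q by blast
    then have "before (u' @ v') y x"
    proof cases
      case 1
      have "before u' y x"
      proof (rule before_subword_transfer[OF z Rp d(1) R(1) d(3) R(2) equ arc 1])
        fix t s assume "(t, s) \<in> arc_inversions (x, y, p, S \<inter> {x<..<y})" "s \<in> R" "t \<in> R"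
        then show "before u t s"
          using inv[of t s] before_in_set[of v t s] R Q unfolding before_append by blast
      qed
      then show ?thesis unfolding before_append by blast
    next
      case 2
      have "before v' y x"
      proof (rule before_subword_transfer[OF z Diff_subset d(2) Q(1) d(4) Q(2) eqv arc 2])
        fix t s assume "(t, s) \<in> arc_inversions (x, y, p, S \<inter> {x<..<y})" "s \<in> ?Q" "t \<in> ?Q"
        then show "before v t s"
          using inv[of t s] before_in_set[of u t s] R Q unfolding before_append by blast
      qed
      then show ?thesis unfolding before_append by blast
    next
      case 3
      then show ?thesis unfolding before_append using R Q by blast
    qed
    then show "(y, x) \<in> inversions (u' @ v')" unfolding inversions_eq_before using xy by simp
  qed
  then show "\<alpha> \<in> arcs_below (Psi z) (u' @ v')" unfolding arcs_below_def using \<alpha> by blast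
qed

text \<open>The terms of the coproduct are grouped by the set \<open>R\<close> of values in the prefix. For fixed \<open>R\<close> a
  term is determined by the two standardized factors, and the set of pairs of factors that occur is
  saturated: replacing the factors by congruent ones stays in the fibre of \<open>D\<close>.\<close>

lemma P_elem_comult_in_tensor_space:
  assumes "Dz \<in> decorated_diagrams X Psi p"
  shows "kP_comult sel (P_elem Psi p Dz) \<in>
    tensor_space (kD X Psi) (kD X Psi :: ('x decperm \<Rightarrow>\<^sub>0 'k::field) set)"
proof -
  obtain D z where Dz: "Dz = (D, z)" and z: "z \<in> X p"
    using assms unfolding decorated_diagrams_def by auto
  let ?A = "{\<rho>. \<rho> \<in> perms p \<and> eta_down p (Psi z) \<rho> = D}"
  let ?Q = "\<lambda>R. {1..p} - R"
  let ?F = "\<lambda>R (\<sigma>, \<tau>). basis_vec ((\<sigma>, sel z R), (\<tau>, sel z (?Q R))) ::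
    'x decperm \<times> 'x decperm \<Rightarrow>\<^sub>0 'k"
  let ?prefix = "\<lambda>(\<rho>, k). set (take k \<rho>)"
  let ?split = "\<lambda>(\<rho>, k). (std_word (take k \<rho>), std_word (drop k \<rho>))"
  let ?C = "\<lambda>R. {c \<in> ?A \<times> {0..p}. ?prefix c = R}"
  have "kP_comult sel (P_elem Psi p Dz) =
      (\<Sum>\<rho>\<in>?A. \<Sum>k = 0..length \<rho>. tensor (basis_vec (std_dec sel (\<rho>, z) {1..k}))
        (basis_vec (std_dec sel (\<rho>, z) ({1..length \<rho>} - {1..k}))))"
    unfolding kP_comult_def Dz P_elem_def by (simp add: linear_extension_sum linear_extension_basis)
  also have "\<dots> = (\<Sum>\<rho>\<in>?A. \<Sum>k = 0..p. ?F (set (take k \<rho>)) (?split (\<rho>, k)))"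
  proof (rule sum.cong[OF refl])
    fix \<rho> assume "\<rho> \<in> ?A"
    then have r: "distinct \<rho>" "set \<rho> = {1..p}" "length \<rho> = p" using permsD[of \<rho> p] by auto
    have "tensor (basis_vec (std_dec sel (\<rho>, z) {1..k}))
        (basis_vec (std_dec sel (\<rho>, z) ({1..length \<rho>} - {1..k}))) =
        ?F (set (take k \<rho>)) (?split (\<rho>, k))" if "k \<in> {0..p}" for k
      using that r stdp_prefix[of \<rho> k] stdp_suffix[of \<rho> k] entry_image_prefix[of k \<rho>]
        entry_image_suffix[of \<rho> k]
      unfolding std_dec_def tensor_basis by simp
    then show "(\<Sum>k = 0..length \<rho>. tensor (basis_vec (std_dec sel (\<rho>, z) {1..k}))
        (basis_vec (std_dec sel (\<rho>, z) ({1..length \<rho>} - {1..k})))) =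
      (\<Sum>k = 0..p. ?F (set (take k \<rho>)) (?split (\<rho>, k)))"
      unfolding r(3) by (intro sum.cong refl) (simp add: r(3))
  qed
  also have "\<dots> = (\<Sum>c\<in>?A \<times> {0..p}. ?F (?prefix c) (?split c))"
    unfolding sum.cartesian_product by (rule sum.cong[OF refl]) auto
  also have "\<dots> = (\<Sum>R\<in>Pow {1..p}. \<Sum>c\<in>?C R. ?F (?prefix c) (?split c))"
  proof (rule sum.group[symmetric])
    show "?prefix ` (?A \<times> {0..p}) \<subseteq> Pow {1..p}"
      using permsD by (auto dest!: in_set_takeD)
  qed auto
  also have "\<dots> = (\<Sum>R\<in>Pow {1..p}. \<Sum>st\<in>?split ` ?C R. ?F R st)"
  proof (rule sum.cong[OF refl])
    fix R assume "R \<in> Pow {1..p}"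
    \<comment> \<open>The set \<open>R\<close> restores both words from their standardizations, and \<open>k\<close> is its cardinality.\<close>
    have inj: "inj_on ?split (?C R)"
    proof (rule inj_onI)
      fix c d assume c: "c \<in> ?C R" and d: "d \<in> ?C R" and eq: "?split c = ?split d"
      obtain \<rho> k where c': "c = (\<rho>, k)" "\<rho> \<in> perms p" "k \<le> p" "set (take k \<rho>) = R" using c by auto
      obtain \<pi> l where d': "d = (\<pi>, l)" "\<pi> \<in> perms p" "l \<le> p" "set (take l \<pi>) = R" using d by auto
      have k: "k = card R" "l = card R"
        using distinct_card[of "take k \<rho>"] distinct_card[of "take l \<pi>"] permsD[OF c'(2)]
          permsD[OF d'(2)] c' d' by auto
      have "set (drop k \<rho>) = {1..p} - R"
        using permsD[OF c'(2)] c'(4) set_take_disj_set_drop_if_distinct[of \<rho> k k]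
          set_append[of "take k \<rho>" "drop k \<rho>"] by auto
      moreover have "set (drop l \<pi>) = {1..p} - R"
        using permsD[OF d'(2)] d'(4) set_take_disj_set_drop_if_distinct[of \<pi> l l]
          set_append[of "take l \<pi>" "drop l \<pi>"] by auto
      ultimately have "take k \<rho> = take l \<pi>" "drop k \<rho> = drop l \<pi>"
        using eq c'(1,4) d'(1,4) map_nth_elem_std_word[of "take k \<rho>"] map_nth_elem_std_word[of "take l \<pi>"]
          map_nth_elem_std_word[of "drop k \<rho>"] map_nth_elem_std_word[of "drop l \<pi>"] by auto
      then have "\<rho> = \<pi>" by (metis append_take_drop_id)
      then show "c = d" using c'(1) d'(1) k by simp
    qed
    have "(\<Sum>c\<in>?C R. ?F (?prefix c) (?split c)) = (\<Sum>c\<in>?C R. ?F R (?split c))"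
      by (rule sum.cong[OF refl]) auto
    then show "(\<Sum>c\<in>?C R. ?F (?prefix c) (?split c)) = (\<Sum>st\<in>?split ` ?C R. ?F R st)"
      by (simp only: sum.reindex[OF inj] comp_def)
  qed
  also have "\<dots> \<in> tensor_space (kD X Psi) (kD X Psi)"
  proof (rule free_vs.subspace_sum[OF subspace_tensor_space])
    fix R assume "R \<in> Pow {1..p}"
    then have R: "R \<subseteq> {1..p}" by blast
    have fin: "finite R" "finite (?Q R)" using R finite_subset by auto
    have split_word: "take k \<rho> @ drop k \<rho> \<in> perms p" "distinct (take k \<rho>)" "distinct (drop k \<rho>)"
        "set (drop k \<rho>) = ?Q R" "k = card R" "p - k = card (?Q R)"
      if c: "(\<rho>, k) \<in> ?C R" for \<rho> k
    proof -
      have r: "\<rho> \<in> perms p" "k \<le> p" "set (take k \<rho>) = R" using c by auto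
      then show "take k \<rho> @ drop k \<rho> \<in> perms p" "distinct (take k \<rho>)" "distinct (drop k \<rho>)"
        using permsD by auto
      show "k = card R" using distinct_card[of "take k \<rho>"] permsD[OF r(1)] r by auto
      then show "p - k = card (?Q R)" using R fin by (simp add: card_Diff_subset)
      show "set (drop k \<rho>) = ?Q R"
        using permsD[OF r(1)] r(3) set_take_disj_set_drop_if_distinct[of \<rho> k k]
          set_append[of "take k \<rho>" "drop k \<rho>"] by auto
    qed
    have "(\<Sum>(\<sigma>, \<tau>)\<in>?split ` ?C R. basis_vec ((\<sigma>, sel z R), (\<tau>, sel z (?Q R)))) \<in>
        tensor_space (kD X Psi) (kD X Psi :: ('x decperm \<Rightarrow>\<^sub>0 'k) set)"
    proof (rule saturated_sum_in_tensor_space[OF sel_closed[OF z R] sel_closed[OF z Diff_subset]])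
      show "?split ` ?C R \<subseteq> perms (card R) \<times> perms (card (?Q R))"
      proof
        fix st assume "st \<in> ?split ` ?C R"
        then obtain \<rho> k where c: "(\<rho>, k) \<in> ?C R" and st: "st = ?split (\<rho>, k)" by auto
        have "length (take k \<rho>) = card R" "length (drop k \<rho>) = card (?Q R)"
          using distinct_card[OF split_word(2)[OF c]] distinct_card[OF split_word(3)[OF c]]
            split_word(4)[OF c] c by auto
        then show "st \<in> perms (card R) \<times> perms (card (?Q R))"
          using std_word_perms[OF split_word(2)[OF c]] std_word_perms[OF split_word(3)[OF c]] st by auto
      qed
      fix \<sigma> \<tau> \<sigma>' \<tau>'
      assume st: "(\<sigma>, \<tau>) \<in> ?split ` ?C R"
        and p': "\<sigma>' \<in> perms (card R)" "\<tau>' \<in> perms (card (?Q R))"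
        and eq: "arcs_below (Psi (sel z R)) \<sigma> = arcs_below (Psi (sel z R)) \<sigma>'"
          "arcs_below (Psi (sel z (?Q R))) \<tau> = arcs_below (Psi (sel z (?Q R))) \<tau>'"
      obtain \<rho> k where c: "(\<rho>, k) \<in> ?C R" and split: "\<sigma> = std_word (take k \<rho>)" "\<tau> = std_word (drop k \<rho>)"
        using st by auto
      have r: "\<rho> \<in> perms p" "eta_down p (Psi z) \<rho> = D" "k \<le> p" "set (take k \<rho>) = R" using c by auto
      let ?u = "map (nth_elem R) \<sigma>'" and ?v = "map (nth_elem (?Q R)) \<tau>'"
      note u = std_word_map_nth_elem[OF fin(1) p'(1)] and v = std_word_map_nth_elem[OF fin(2) p'(2)]
      have uv: "?u @ ?v \<in> perms p"
        by (rule permsI) (use u v R in auto)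
      have len: "length ?u = k" using permsD[OF p'(1)] split_word(5)[OF c] by simp
      have "arcs_below (Psi z) (take k \<rho> @ drop k \<rho>) = arcs_below (Psi z) (?u @ ?v)"
      proof (rule subset_antisym)
        show "arcs_below (Psi z) (take k \<rho> @ drop k \<rho>) \<subseteq> arcs_below (Psi z) (?u @ ?v)"
          by (rule arcs_below_append[OF z split_word(1)[OF c] uv r(4) u(3)])
            (simp_all only: u(1) v(1) split[symmetric] eq)
        show "arcs_below (Psi z) (?u @ ?v) \<subseteq> arcs_below (Psi z) (take k \<rho> @ drop k \<rho>)"
          by (rule arcs_below_append[OF z uv split_word(1)[OF c] u(3) r(4)])
            (simp_all only: u(1) v(1) split[symmetric] eq)
      qed
      then have "eta_down p (Psi z) (?u @ ?v) = D"
        using eta_down_eq_iff[OF Psi_ideal[OF z] r(1) uv] r(2) by simp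
      then have "(?u @ ?v, k) \<in> ?C R" using uv r(3) len u(3) by simp
      moreover have "(\<sigma>', \<tau>') = ?split (?u @ ?v, k)" using len u(1) v(1) by simp
      ultimately show "(\<sigma>', \<tau>') \<in> ?split ` ?C R" by (rule rev_image_eqI)
    qed
    then show "(\<Sum>st\<in>?split ` ?C R. ?F R st) \<in> tensor_space (kD X Psi) (kD X Psi)" .
  qed
  finally show ?thesis .
qed

lemma kD_mult_closed:
  assumes "u \<in> kD X Psi" "v \<in> kD X Psi"
  shows "kP_mult conc u v \<in> (kD X Psi :: ('x decperm \<Rightarrow>\<^sub>0 'k::field) set)"
  unfolding kP_mult_def
proof (rule bilinear_extension_in_subspace[OF subspace_kD _ assms[unfolded kD_def]])
  fix u v :: "'x decperm \<Rightarrow>\<^sub>0 'k"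
  assume "u \<in> (\<Union>n. P_elem Psi n ` decorated_diagrams X Psi n)"
    "v \<in> (\<Union>n. P_elem Psi n ` decorated_diagrams X Psi n)"
  then obtain m n Dx Ey where "Dx \<in> decorated_diagrams X Psi m" "Ey \<in> decorated_diagrams X Psi n"
    "u = P_elem Psi m Dx" "v = P_elem Psi n Ey" by blast
  then show "bilinear_extension (\<lambda>(\<sigma>, x) (\<tau>, y). \<Sum>\<rho>\<in>shifted_shuffle \<sigma> \<tau>. basis_vec (\<rho>, conc x y)) u v
      \<in> kD X Psi"
    using P_elem_mult_in_kD unfolding kP_mult_def by blast
qed

lemma kD_comult_closed:
  assumes "u \<in> kD X Psi"
  shows "kP_comult sel u \<in> tensor_space (kD X Psi) (kD X Psi :: ('x decperm \<Rightarrow>\<^sub>0 'k::field) set)"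
  unfolding kP_comult_def
proof (rule linear_extension_in_subspace[OF subspace_tensor_space _ assms[unfolded kD_def]])
  fix u :: "'x decperm \<Rightarrow>\<^sub>0 'k"
  assume "u \<in> (\<Union>n. P_elem Psi n ` decorated_diagrams X Psi n)"
  then obtain n Dz where "Dz \<in> decorated_diagrams X Psi n" "u = P_elem Psi n Dz" by blast
  then show "linear_extension (\<lambda>(\<rho>, z). \<Sum>k = 0..length \<rho>.
      tensor (basis_vec (std_dec sel (\<rho>, z) {1..k}))
        (basis_vec (std_dec sel (\<rho>, z) ({1..length \<rho>} - {1..k})))) u \<in> tensor_space (kD X Psi) (kD X Psi)"
    using P_elem_comult_in_tensor_space unfolding kP_comult_def by blast
qed

end

theorem theorem17:
  fixes X :: "nat \<Rightarrow> 'x set"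
    and conc :: "'x \<Rightarrow> 'x \<Rightarrow> 'x"
    and sel :: "'x \<Rightarrow> nat set \<Rightarrow> 'x"
    and Psi :: "'x \<Rightarrow> arc set"
  assumes "decoration_set X conc sel"
    and "conservative_function X conc sel Psi"
  shows "graded_subspace (kP_degree X) (kD X Psi :: ('x decperm \<Rightarrow>\<^sub>0 'k::field) set) \<and>
    hopf_subalgebra (kP X) (kP_mult conc) (kP_comult sel)
      (kD X Psi :: ('x decperm \<Rightarrow>\<^sub>0 'k::field) set)"
proof -
  interpret conservative_function X conc sel Psi by (rule assms(2))
  show ?thesis
    unfolding hopf_subalgebra_def
    by (intro conjI ballI image_subsetI graded_subspace_kD kD_subset_kP subspace_kD
        kD_mult_closed kD_comult_closed)
qed

end
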